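(* Let $q\in\mathbb C$ with $0<|q|<1$. For generic nonzero complex numbers $a_1,\dots,a_4$ and $b_1,\dots,b_4$ (see context), $$\sum_{m=-\infty}^\infty\oint \prod_{j=1}^4\frac{(q^{1+m/2}/(a_jz);q)_\infty\,(q^{1-m/2}z/a_j;q)_\infty}{(q^{m/2}b_jz;q)_\infty\,(q^{-m/2}b_j/z;q)_\infty}\;\frac{(1-q^mz^2)(1-q^mz^{-2})}{q^mz^{4m}}\;\frac{dz}{2\pi \mathrm i z} =\frac{2\,(b_1b_2b_3b_4;q)_\infty}{(q/(a_1a_2a_3a_4);q)_\infty}\prod_{1\leq j<k\leq 4}\frac{(q/(a_ja_k);q)_\infty}{(b_jb_k;q)_\infty}.$$
   Context: Notation: $(a;q)_\infty=\prod_{i=0}^\infty(1-aq^i)$. A square root $q^{1/2}$ of $q$ is fixed and $q^{m/2}=(q^{1/2})^m$ for $m\in\mathbb Z$. Genericity: the parameters are assumed generic, so that the poles of the integrand split naturally into geometric sequences converging to $0$ and geometric sequences converging to $\infty$. For each $m$, the sequences converging to $0$ are $z=q^{-m/2+k}b_j$ and those converging to $\infty$ are $z=q^{-m/2-k}/b_j$ ($1\le j\le 4$, $k\ge 0$); in particular, the two types have no point in common. Contour: for each $m$, the integral is over a positively oriented closed contour in $\mathbb C\setminus\{0\}$, going once around $0$, that separates these two types of poles: the sequences converging to $0$ lie inside and the sequences converging to $\infty$ lie outside.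
   Formalization: The formal theorem adds the condition |q| < |a_1a_2a_3a_4|, which is needed for convergence: the m-th term behaves like C(q/(a_1a_2a_3a_4))^m with C nonzero for generic parameters, so otherwise the sum over m diverges. *)

theory Defs
  imports "HOL-Complex_Analysis.Complex_Analysis"
begin

definition qpoch_inf :: "complex \<Rightarrow> complex \<Rightarrow> complex" where
  "qpoch_inf a q = (\<Prod>i. 1 - a * q ^ i)"

text \<open>
  Throughout, \<open>s\<close> is the fixed square root of \<open>q\<close>, so that \<open>s powi m\<close> stands for the power of
  \<open>q\<close> with exponent \<open>m/2\<close>. The parameters \<open>a j\<close>, \<open>b j\<close> are only used for indices \<open>1 \<le> j \<le> 4\<close>.
\<close>

definition integrand ::
    "complex \<Rightarrow> complex \<Rightarrow> (nat \<Rightarrow> complex) \<Rightarrow> (nat \<Rightarrow> complex) \<Rightarrow> int \<Rightarrow> complex \<Rightarrow> complex" where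
  "integrand q s a b m z =
     (\<Prod>j=1..4. (qpoch_inf (s powi (2 + m) / (a j * z)) q * qpoch_inf (s powi (2 - m) * z / a j) q)
               / (qpoch_inf (s powi m * b j * z) q * qpoch_inf (s powi (- m) * b j / z) q))
     * ((1 - q powi m * z powi 2) * (1 - q powi m * z powi (- 2))
        / (q powi m * z powi (4 * m)))"

definition poles_to_zero :: "complex \<Rightarrow> complex \<Rightarrow> (nat \<Rightarrow> complex) \<Rightarrow> int \<Rightarrow> complex set" where
  "poles_to_zero q s b m = {s powi (- m) * q ^ k * b j | j k. j \<in> {1..4}}"

definition poles_to_infinity :: "complex \<Rightarrow> complex \<Rightarrow> (nat \<Rightarrow> complex) \<Rightarrow> int \<Rightarrow> complex set" where
  "poles_to_infinity q s b m = {s powi (- m) / (q ^ k * b j) | j k. j \<in> {1..4}}"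

text \<open>
  Closed contours in the punctured plane going once around 0 and separating the two types of
  poles. Inside and outside are expressed by winding numbers 1 and 0; the contour need not be a
  simple curve.
\<close>

definition separating_contour ::
    "complex \<Rightarrow> complex \<Rightarrow> (nat \<Rightarrow> complex) \<Rightarrow> int \<Rightarrow> (real \<Rightarrow> complex) \<Rightarrow> bool" where
  "separating_contour q s b m \<gamma> \<longleftrightarrow>
     valid_path \<gamma> \<and> pathfinish \<gamma> = pathstart \<gamma> \<and>
     path_image \<gamma> \<inter> ({0} \<union> poles_to_zero q s b m \<union> poles_to_infinity q s b m) = {} \<and>
     winding_number \<gamma> 0 = 1 \<and>
     (\<forall>p \<in> poles_to_zero q s b m. winding_number \<gamma> p = 1) \<and>
     (\<forall>p \<in> poles_to_infinity q s b m. winding_number \<gamma> p = 0)"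

end

(*
  Put x_j = 1/a_j, u = q^(m/2) z and v = u q^(-m). In the variable u all contours can be deformed to
  the one for m = 0, the denominator no longer depends on m, and by quasi-periodicity of theta
  functions the sum over m of the numerators is Bailey's very well poised 6psi6 series in u.
  A telescoping identity relates its values at x_j and q x_j, and letting all x_j tend to 0 reduces
  it to the series Theta(u) with x = 0. What remains is the Askey-Wilson integral with
  weight (1 - u^2) Theta(u). It is evaluated in the same way, the telescoping being replaced by
  the shift of the contour by the factor q; as all b_j tend to 0, only the constant term 2
  of (1 - u^2) Theta(u) survives. Neither Jacobi's triple product nor a product formula for Theta
  is needed.
*)
theory Submission
  imports Defs
begin

section \<open>The infinite q-shifted factorial\<close>

text \<open>One rational identity, \<open>beta_identity\<close>, drives both recurrences: its
  right-hand side is a difference of two terms that v -> 1/v exchanges up to powers of v, and these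
  become T(m) and T(m - 1) in the series, f(u) and f(u/q)/q under the integral. Parameters move
  towards 0 only, because this direction preserves the hypotheses: |q x_1 x_2 x_3 x_4| < 1 is
  inherited, and a fixed separating contour remains separating, however large the b_j are. The price
  is that the limit has to be controlled down to parameters equal to 0; therefore the series is
  estimated for t x_j, uniformly for |t| <= 1. The recurrence factors may vanish, so both
  evaluations are proved in cross-multiplied form. Division by the resulting factorials takes place
  only at the end, where the separation of the poles and the convergence condition exclude zeros.
  Besides holomorphy, two properties of Theta enter: Theta(q u) = Theta(u) / (q^3 u^4), which
  matches the four pairs of factorials in the denominator, and its explicit expansion.\<close>

context
  fixes q :: complex
  assumes q: "0 < norm q" "norm q < 1"
begin

lemma convergent_prod_qpoch: "convergent_prod (\<lambda>i. 1 - a * q ^ i)"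
proof -
  have "summable (\<lambda>i. norm (- a * q ^ i))"
    using q by (auto simp: norm_mult norm_power intro!: summable_mult summable_geometric)
  then have "abs_convergent_prod (\<lambda>i. 1 + - a * q ^ i)"
    by (intro summable_imp_abs_convergent_prod) simp
  then show ?thesis
    using abs_convergent_prod_imp_convergent_prod by fastforce
qed

lemma qpoch_inf_LIMSEQ: "(\<lambda>n. \<Prod>i\<le>n. 1 - a * q ^ i) \<longlonglongrightarrow> qpoch_inf a q"
  unfolding qpoch_inf_def by (rule convergent_prod_LIMSEQ) (rule convergent_prod_qpoch)

lemma qpoch_inf_rec: "qpoch_inf a q = (1 - a) * qpoch_inf (q * a) q"
proof (rule LIMSEQ_unique)
  show "(\<lambda>n. \<Prod>i\<le>Suc n. 1 - a * q ^ i) \<longlonglongrightarrow> qpoch_inf a q"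
    using qpoch_inf_LIMSEQ by (rule LIMSEQ_Suc)
  have "(\<lambda>n. (1 - a) * (\<Prod>i\<le>n. 1 - (q * a) * q ^ i)) \<longlonglongrightarrow> (1 - a) * qpoch_inf (q * a) q"
    by (intro tendsto_intros qpoch_inf_LIMSEQ)
  then show "(\<lambda>n. \<Prod>i\<le>Suc n. 1 - a * q ^ i) \<longlonglongrightarrow> (1 - a) * qpoch_inf (q * a) q"
    by (subst prod.atMost_Suc_shift) (simp add: mult_ac)
qed

lemma qpoch_inf_0: "qpoch_inf 0 q = 1"
  by (simp add: qpoch_inf_def)

lemma qpoch_inf_split: "qpoch_inf a q = (\<Prod>i<n. 1 - a * q ^ i) * qpoch_inf (a * q ^ n) q"
proof (induction n)
  case (Suc n)
  then show ?case using qpoch_inf_rec[of "a * q ^ n"] by (simp add: mult_ac)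
qed simp

lemma qpoch_inf_eq_0_iff: "qpoch_inf a q = 0 \<longleftrightarrow> (\<exists>k. a * q ^ k = 1)"
proof
  assume "qpoch_inf a q = 0"
  then show "\<exists>k. a * q ^ k = 1"
    unfolding qpoch_inf_def
    using prodinf_nonzero[OF convergent_prod_qpoch, of a] by force
next
  assume "\<exists>k. a * q ^ k = 1"
  then obtain k where "a * q ^ k = 1" by auto
  then show "qpoch_inf a q = 0"
    using qpoch_inf_split[of a "Suc k"] by simp
qed

section \<open>Growth of the infinite factorial\<close>

lemma norm_qpoch_inf_le: "norm (qpoch_inf a q) \<le> exp (norm a / (1 - norm q))"
proof (rule LIMSEQ_le_const2)
  show "(\<lambda>n. norm (\<Prod>i\<le>n. 1 - a * q ^ i)) \<longlonglongrightarrow> norm (qpoch_inf a q)"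
    by (intro tendsto_intros qpoch_inf_LIMSEQ)
  have "norm (\<Prod>i\<le>n. 1 - a * q ^ i) \<le> exp (norm a / (1 - norm q))" for n
  proof -
    have "norm (\<Prod>i\<le>n. 1 - a * q ^ i) \<le> (\<Prod>i\<le>n. 1 + norm a * norm q ^ i)"
      unfolding prod_norm [symmetric]
      by (intro prod_mono) (auto simp: norm_mult norm_power intro!: order_trans [OF norm_triangle_ineq4])
    also have "\<dots> \<le> exp (\<Sum>i\<le>n. norm a * norm q ^ i)"
      by (intro prod_le_exp_sum) auto
    also have "(\<Sum>i\<le>n. norm a * norm q ^ i) \<le> (\<Sum>i. norm a * norm q ^ i)"
      using q by (intro sum_le_suminf summable_mult summable_geometric) auto
    also have "(\<Sum>i. norm a * norm q ^ i) = norm a / (1 - norm q)"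
      using q by (subst suminf_mult) (auto simp: suminf_geometric summable_geometric)
    finally show ?thesis by simp
  qed
  then show "\<exists>N. \<forall>n\<ge>N. norm (\<Prod>i\<le>n. 1 - a * q ^ i) \<le> exp (norm a / (1 - norm q))" by blast
qed

text \<open>Taking \<open>X\<close> out of each factor leaves a partial product of a convergent one,
  bounded independently of n; the growth in n is thereby exactly exponential.\<close>

lemma prod_add_powers_le:
  assumes "X > 0"
  shows "(\<Prod>i<n. X + norm q ^ i) \<le> X ^ n * exp (1 / X / (1 - norm q))"
proof -
  have "(\<Prod>i<n. X + norm q ^ i) = (\<Prod>i<n. X * (1 + 1 / X * norm q ^ i))"
    using assms by (intro prod.cong) (auto simp: field_simps)
  also have "\<dots> = X ^ n * (\<Prod>i<n. 1 + 1 / X * norm q ^ i)"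
    by (simp add: prod.distrib)
  also have "(\<Prod>i<n. 1 + 1 / X * norm q ^ i) \<le> exp (\<Sum>i<n. 1 / X * norm q ^ i)"
    using assms by (intro prod_le_exp_sum) auto
  also have "(\<Sum>i<n. 1 / X * norm q ^ i) \<le> (\<Sum>i. 1 / X * norm q ^ i)"
    using q assms by (intro sum_le_suminf summable_mult summable_geometric) auto
  also have "(\<Sum>i. 1 / X * norm q ^ i) = 1 / X / (1 - norm q)"
    using q by (subst suminf_mult) (auto simp: suminf_geometric summable_geometric)
  finally show ?thesis using assms by simp
qed

text \<open>The n new factors are 1 - c/q^(i+1) = (q^i - c/q) / q^i, in reversed order. Writing them
  over q^i isolates the quadratic power of q, which in the bilateral series has to cancel exactly
  against the Gaussian factor.\<close>

lemma qpoch_inf_shift_down: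
  "qpoch_inf (c / q ^ n) q = (\<Prod>i<n. q ^ i - c / q) * qpoch_inf c q / q ^ (\<Sum>i<n. i)"
proof -
  have "(\<Prod>i<n. 1 - c / q ^ n * q ^ i) = (\<Prod>i<n. 1 - c / q ^ Suc i)"
    by (rule prod.reindex_bij_witness [of _ "\<lambda>i. n - Suc i" "\<lambda>i. n - Suc i"])
       (use q in \<open>auto simp: power_diff field_simps simp flip: power_add power_Suc\<close>)
  also have "\<dots> = (\<Prod>i<n. (q ^ i - c / q) / q ^ i)"
    using q by (intro prod.cong) (auto simp: field_simps)
  also have "\<dots> = (\<Prod>i<n. q ^ i - c / q) / q ^ (\<Sum>i<n. i)"
    by (simp add: prod_dividef power_sum)
  finally show ?thesis
    using q qpoch_inf_split [of "c / q ^ n" n] by simp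
qed

text \<open>Only an upper bound \<open>X\<close> of |c| enters, so the estimate stays valid as c
  tends to 0, while \<open>X > 0\<close> lets the power be factored out.\<close>

lemma norm_qpoch_inf_shift_down_le:
  assumes "norm c \<le> X" "X > 0"
  shows "norm (qpoch_inf (c / q ^ n) q) \<le>
    (X / norm q) ^ n / norm q ^ (\<Sum>i<n. i) * exp ((X + norm q / X) / (1 - norm q))"
proof -
  have "norm (\<Prod>i<n. q ^ i - c / q) \<le> (\<Prod>i<n. X / norm q + norm q ^ i)"
    unfolding prod_norm [symmetric]
  proof (intro prod_mono conjI)
    fix i
    have "norm (q ^ i - c / q) \<le> norm q ^ i + norm c / norm q"
      by (metis norm_divide norm_power norm_triangle_ineq4)
    also have "norm c / norm q \<le> X / norm q"
      using assms q by (intro divide_right_mono) auto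
    finally show "norm (q ^ i - c / q) \<le> X / norm q + norm q ^ i" by simp
  qed auto
  also have "\<dots> \<le> (X / norm q) ^ n * exp (1 / (X / norm q) / (1 - norm q))"
    using assms q by (intro prod_add_powers_le) simp
  finally have 1: "norm (\<Prod>i<n. q ^ i - c / q) \<le> (X / norm q) ^ n * exp (norm q / X / (1 - norm q))"
    by simp
  have 2: "norm (qpoch_inf c q) \<le> exp (X / (1 - norm q))"
    by (rule order_trans [OF norm_qpoch_inf_le]) (use assms q in \<open>simp add: divide_right_mono\<close>)
  have "norm (qpoch_inf (c / q ^ n) q) \<le>
      ((X / norm q) ^ n * exp (norm q / X / (1 - norm q))) * exp (X / (1 - norm q)) / norm q ^ (\<Sum>i<n. i)"
    unfolding qpoch_inf_shift_down norm_mult norm_divide norm_power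
    using assms q by (intro divide_right_mono mult_mono 1 2) auto
  also have "\<dots> = (X / norm q) ^ n / norm q ^ (\<Sum>i<n. i) * exp ((X + norm q / X) / (1 - norm q))"
    by (simp add: exp_add add_divide_distrib)
  finally show ?thesis .
qed

section \<open>Analytic dependence on the argument\<close>

lemma holomorphic_qpoch_inf: "(\<lambda>a. qpoch_inf a q) holomorphic_on UNIV"
proof (rule holomorphic_uniform_sequence)
  show "open (UNIV :: complex set)" by simp
  show "(\<lambda>a. \<Prod>i<n. 1 - a * q ^ i) holomorphic_on UNIV" for n
    by (intro holomorphic_intros)
  fix z :: complex
  \<comment> \<open>M-test on the closed unit disc around \<open>z\<close>, where the n-th factor
    differs from 1 by at most (|z| + 1) |q|^n.\<close>
  have "uniformly_convergent_on (cball z 1) (\<lambda>N x. \<Sum>n<N. norm (- x * q ^ n))"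
  proof (rule Weierstrass_m_test'_ev)
    show "\<forall>\<^sub>F n in sequentially. \<forall>x\<in>cball z 1. norm (norm (- x * q ^ n)) \<le> (norm z + 1) * norm q ^ n"
    proof (intro always_eventually allI ballI)
      fix n x assume "x \<in> cball z 1"
      then have "norm x \<le> norm z + 1"
        by (metis dist_norm mem_cball norm_minus_commute norm_triangle_sub add.commute add_le_cancel_left order_trans)
      then show "norm (norm (- x * q ^ n)) \<le> (norm z + 1) * norm q ^ n"
        by (simp add: norm_mult norm_power mult_right_mono)
    qed
    show "summable (\<lambda>n. (norm z + 1) * norm q ^ n)"
      using q by (intro summable_mult summable_geometric) auto
  qed
  then have "uniformly_convergent_on (cball z 1) (\<lambda>N x. \<Prod>n<N. 1 + - x * q ^ n)"
    by (intro uniformly_convergent_on_prod) (auto intro!: continuous_intros)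
  then obtain l where l: "uniform_limit (cball z 1) (\<lambda>N x. \<Prod>n<N. 1 - x * q ^ n) l sequentially"
    by (auto simp: uniformly_convergent_on_def)
  have "l x = qpoch_inf x q" if "x \<in> cball z 1" for x
    using tendsto_uniform_limitI [OF l that] qpoch_inf_LIMSEQ [of x]
    by (metis LIMSEQ_lessThan_iff_atMost LIMSEQ_unique)
  then have "uniform_limit (cball z 1) (\<lambda>N x. \<Prod>n<N. 1 - x * q ^ n) (\<lambda>x. qpoch_inf x q) sequentially"
    using iffD1 [OF uniform_limit_cong' l] by auto
  then show "\<exists>d>0. cball z d \<subseteq> UNIV \<and>
      uniform_limit (cball z d) (\<lambda>N x. \<Prod>n<N. 1 - x * q ^ n) (\<lambda>x. qpoch_inf x q) sequentially"
    by (intro exI [of _ 1]) auto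
qed

lemma holomorphic_on_qpoch_inf:
  "f holomorphic_on A \<Longrightarrow> (\<lambda>x. qpoch_inf (f x) q) holomorphic_on A"
  using holomorphic_on_compose_gen [OF _ holomorphic_qpoch_inf, of f A] by (simp add: o_def)

lemma continuous_on_qpoch_inf:
  fixes f :: "'a :: topological_space \<Rightarrow> complex"
  shows "continuous_on A f \<Longrightarrow> continuous_on A (\<lambda>x. qpoch_inf (f x) q)"
  using continuous_on_compose2 [OF holomorphic_on_imp_continuous_on [OF holomorphic_qpoch_inf]] by auto

lemma tendsto_qpoch_inf:
  assumes "(f \<longlongrightarrow> a) F"
  shows "((\<lambda>x. qpoch_inf (f x) q) \<longlongrightarrow> qpoch_inf a q) F"
  using continuous_on_tendsto_compose [OF holomorphic_on_imp_continuous_on [OF holomorphic_qpoch_inf] assms]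
  by auto

end

section \<open>The bilateral series\<close>

(* In terms of v = u q^(-m) this is v^e prod_j (c_j v, d_j / v; q)_infinity times a multiplier; the
   difference of the cases e = 0 and e = -2 gives the factor 1 - v^(-2) of the integrand. *)
definition psi_term ::
  "complex \<Rightarrow> int \<Rightarrow> (nat \<Rightarrow> complex) \<Rightarrow> (nat \<Rightarrow> complex) \<Rightarrow> complex \<Rightarrow> int \<Rightarrow> complex" where
  "psi_term q e c d u m =
     (u * q powi (-m)) powi e
     * (\<Prod>j=1..4. qpoch_inf (c j * u * q powi (-m)) q * qpoch_inf (d j * q powi m / u) q)
     * (q powi (2*m*m - m) * u powi (-4*m))"

context
  fixes q :: complex
  assumes q: "0 < norm q" "norm q < 1"
begin

text \<open>The reflection m -> -m amounts to u -> 1/u with the two families exchanged. The linear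
  part of the exponent 2m^2 - m changes sign, and the factor q^(2m) so created turns e into -2 - e;
  in particular e = 0 and e = -2 are interchanged. Bounds for negative m thus follow from those for
  nonnegative m.\<close>

lemma psi_term_uminus:
  assumes "u \<noteq> 0"
  shows "psi_term q e c d u (-m) = (1/u)^2 * psi_term q (-2 - e) d c (1/u) m"
proof -
  have [simp]: "q \<noteq> 0" using q by auto
  have "(u * q powi m) powi e * (q powi (2*m*m + m) * u powi (4*m)) =
        (1/u)^2 * ((1/u * q powi (-m)) powi (-2 - e) * (q powi (2*m*m - m) * (1/u) powi (-4*m)))"
    using assms
    by (simp add: power_int_mult_distrib power_int_divide_distrib power_int_minus power_int_diff
        power_int_add field_simps power2_eq_square flip: power_int_mult)
       (simp add: power_int_mult power2_eq_square)
  then show ?thesis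
    using assms by (simp add: psi_term_def mult_ac)
qed

text \<open>Since (q u) q^(-m) = u q^(-(m-1)), all factors depending on this combination move to
  index m - 1, and only the Gaussian factor leaves a multiplier.\<close>

lemma psi_term_q_shift:
  assumes "u \<noteq> 0"
  shows "psi_term q e c d (q * u) m = 1 / (q^3 * u^4) * psi_term q e c d u (m - 1)"
proof -
  have q0 [simp]: "q \<noteq> 0" using q by auto
  have 1: "q * u * q powi (-m) = u * q powi (-(m-1))"
    by (simp add: power_int_minus power_int_diff field_simps)
  have 2: "q powi m / (q * u) = q powi (m - 1) / u"
    using assms by (simp add: power_int_diff field_simps)
  have 3: "q powi (2*m*m - m) * (q * u) powi (-4*m) =
       1 / (q^3 * u^4) * (q powi (2*(m-1)*(m-1) - (m-1)) * u powi (-4*(m-1)))"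
  proof -
    have "2*(m-1)*(m-1) - (m-1) = (2*m*m - m) + (-4*m) + 3" "-4*(m-1) = -4*m + 4"
      by (simp_all add: algebra_simps)
    then have "q powi (2*(m-1)*(m-1) - (m-1)) = q powi (2*m*m - m) * q powi (-4*m) * q ^ 3"
      "u powi (-4*(m-1)) = u powi (-4*m) * u ^ 4"
      using assms by (simp_all only: power_int_add [of q] power_int_add [of u] q0 simp_thms) simp_all
    then show ?thesis
      using assms by (simp add: power_int_mult_distrib)
  qed
  have 4: "c j * (q * u) * q powi (-m) = c j * u * q powi (-(m-1))" for j
    using 1 by (metis mult.assoc)
  have 5: "d j * q powi m / (q * u) = d j * q powi (m - 1) / u" for j
    using 2 by (metis times_divide_eq_right)
  show ?thesis
    unfolding psi_term_def 1 3 4 5 by (simp add: mult_ac)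
qed

text \<open>The four factorials in c_j u q^(-n) grow at most like |prod c_j|^n (|u|/|q|)^(4n)
  |q|^(-2n(n-1)). The Gaussian factor cancels the quadratic part up to |q|^n, u^(-4n) cancels the
  powers of u, and (u q^(-n))^e contributes |q|^(-en); this explains the ratio. The value t = 0 is
  covered because |c_j|, not |t c_j|, is used as the bound in the factorials.\<close>

lemma psi_term_nonneg_bound:
  assumes r: "0 < r" "r \<le> R" and c: "\<And>j. j \<in> {1..4} \<Longrightarrow> c j \<noteq> 0"
  obtains K where "0 \<le> K" "\<And>n u t. r \<le> norm u \<Longrightarrow> norm u \<le> R \<Longrightarrow> norm t \<le> 1 \<Longrightarrow>
    norm (psi_term q e (\<lambda>j. t * c j) (\<lambda>j. t * d j) u (int n))
      \<le> K * (norm (\<Prod>j=1..4. c j) * norm q powi (-3 - e)) ^ n"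
proof -
  define A where "A j = exp ((norm (c j) * R + norm q / (norm (c j) * r)) / (1 - norm q))" for j
  define B where "B j = exp (norm (d j) / r / (1 - norm q))" for j
  \<comment> \<open>Adding the values at both radii bounds |u|^e for either sign of
    \<open>e\<close>.\<close>
  define K where "K = (r powi e + R powi e) * (\<Prod>j=1..4. A j * B j)"
  have q0 [simp]: "q \<noteq> 0" using q by auto
  show thesis
  proof
    show "0 \<le> K" using r by (auto simp: K_def A_def B_def intro!: mult_nonneg_nonneg prod_nonneg)
    fix n :: nat and u t :: complex
    assume u: "r \<le> norm u" "norm u \<le> R" and t: "norm t \<le> 1"
    have u0: "norm u > 0" using u r by linarith
    then have u0' [simp]: "u \<noteq> 0" by auto
    have "norm (qpoch_inf (t * c j * u * q powi (- int n)) q * qpoch_inf (t * d j * q powi int n / u) q)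
        \<le> (norm (c j) * (norm u / norm q)) ^ n / norm q ^ (\<Sum>i<n. i) * (A j * B j)" if j: "j \<in> {1..4}" for j
    proof -
      have cj: "norm (c j) > 0" using c[OF j] by simp
      have "norm (t * c j * u) \<le> norm (c j) * norm u"
        using t by (simp add: norm_mult mult_right_mono mult_left_le_one_le mult.assoc)
      then have "norm (qpoch_inf (t * c j * u / q ^ n) q) \<le> (norm (c j) * norm u / norm q) ^ n / norm q ^ (\<Sum>i<n. i)
          * exp ((norm (c j) * norm u + norm q / (norm (c j) * norm u)) / (1 - norm q))"
        by (rule norm_qpoch_inf_shift_down_le [OF q]) (use cj u0 in simp)
      also have "\<dots> \<le> (norm (c j) * norm u / norm q) ^ n / norm q ^ (\<Sum>i<n. i) * A j"
        unfolding A_def using u r cj q u0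
        by (intro mult_left_mono) (auto intro!: divide_right_mono add_mono mult_left_mono divide_left_mono)
      finally have 1: "norm (qpoch_inf (t * c j * u * q powi (- int n)) q)
          \<le> (norm (c j) * (norm u / norm q)) ^ n / norm q ^ (\<Sum>i<n. i) * A j"
        by (simp add: power_int_minus field_simps)
      have "norm (t * d j * q powi int n / u) \<le> 1 * norm (d j) * 1 / r"
        unfolding norm_mult norm_divide
        using r u t q by (intro frac_le mult_mono) (auto simp: norm_power power_le_one)
      then have 2: "norm (qpoch_inf (t * d j * q powi int n / u) q) \<le> B j"
        unfolding B_def using q
        by (intro order_trans [OF norm_qpoch_inf_le [OF q]])
           (use divide_right_mono [of _ "norm (d j) / r" "1 - norm q"] in auto)
      show ?thesis
        using mult_mono [OF 1 2] u0 cj q unfolding norm_mult by (simp add: A_def mult_ac)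
    qed
    then have "norm (\<Prod>j=1..4. qpoch_inf (t * c j * u * q powi (- int n)) q * qpoch_inf (t * d j * q powi int n / u) q)
        \<le> (\<Prod>j=1..4. (norm (c j) * (norm u / norm q)) ^ n / norm q ^ (\<Sum>i<n. i) * (A j * B j))"
      unfolding prod_norm [symmetric] by (intro prod_mono) auto
    also have "\<dots> = (norm (\<Prod>j=1..4. c j) * (norm u / norm q) ^ 4) ^ n / norm q ^ (4 * (\<Sum>i<n. i)) * (\<Prod>j=1..4. A j * B j)"
      by (simp add: prod.distrib prod_dividef power_mult_distrib prod_norm power_divide
          flip: prod_power_distrib power_mult) (simp add: mult_ac)
    finally have 1: "norm (\<Prod>j=1..4. qpoch_inf (t * c j * u * q powi (- int n)) q * qpoch_inf (t * d j * q powi int n / u) q)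
        \<le> (norm (\<Prod>j=1..4. c j) * (norm u / norm q) ^ 4) ^ n / norm q ^ (4 * (\<Sum>i<n. i)) * (\<Prod>j=1..4. A j * B j)" .
    have "norm u powi e \<le> r powi e + R powi e"
    proof (cases "e \<ge> 0")
      case True
      then show ?thesis using power_int_mono [of "norm u" R e] u r by (smt (verit) zero_le_power_int)
    next
      case False
      then show ?thesis using power_int_antimono [of r "norm u" e] u r by (smt (verit) zero_le_power_int)
    qed
    then have 2: "norm ((u * q powi (- int n)) powi e) \<le> (r powi e + R powi e) * norm q powi (- int n * e)"
      using q by (simp add: norm_mult norm_power_int power_int_mult_distrib flip: power_int_mult)
    have "norm (psi_term q e (\<lambda>j. t * c j) (\<lambda>j. t * d j) u (int n)) \<le>
       (r powi e + R powi e) * norm q powi (- int n * e) *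
       ((norm (\<Prod>j=1..4. c j) * (norm u / norm q) ^ 4) ^ n / norm q ^ (4 * (\<Sum>i<n. i)) * (\<Prod>j=1..4. A j * B j))
       * (norm q powi (2*int n*int n - int n) * norm u powi (-4*int n))"
      unfolding psi_term_def norm_mult
      by (intro mult_mono) (use 1 2 r in \<open>auto simp: norm_mult norm_power_int A_def B_def
            intro!: mult_nonneg_nonneg prod_nonneg divide_nonneg_nonneg\<close>)
    also have "\<dots> = K * (norm (\<Prod>j=1..4. c j) * norm q powi (-3 - e)) ^ n"
    proof -
      have "int (4 * (\<Sum>i<n. i)) = 2 * int n * int n - 2 * int n"
        by (induction n) (simp_all add: algebra_simps)
      then have e1: "norm q ^ (4 * (\<Sum>i<n. i)) = norm q powi (2 * int n * int n - 2 * int n)"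
        by (metis power_int_of_nat)
      have e2: "norm q powi (2*int n*int n - int n) = norm q powi (2 * int n * int n - 2 * int n) * norm q ^ n"
        by (subst power_int_of_nat [symmetric], subst power_int_add [symmetric]) (auto simp: algebra_simps)
      have e3: "norm u powi (-4*int n) = 1 / (norm u ^ 4) ^ n"
        by (simp add: power_int_minus power_int_mult divide_simps)
      have e4: "norm q powi (- int n * e) = (norm q powi (-e)) ^ n"
        by (simp add: mult.commute flip: power_int_mult power_int_of_nat)
      have e5: "norm q powi (-3 - e) = norm q powi (-e) * norm q / norm q ^ 4"
      proof -
        have "-3 - e = -e + (-3)" by simp
        then have "norm q powi (-3 - e) = norm q powi (-e + (-3))" by (simp only:)
        also have "\<dots> = norm q powi (-e) * norm q powi (-3)"
          using q by (intro power_int_add) auto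
        also have "norm q powi (-3) = norm q / norm q ^ 4"
          using q by (simp add: power_int_minus field_simps eval_nat_numeral)
        finally show ?thesis by (simp only: times_divide_eq_right)
      qed
      show ?thesis
        unfolding K_def e1 e2 e3 e4 e5 power_mult_distrib power_divide using u0 q by (simp add: field_simps)
    qed
    finally show "norm (psi_term q e (\<lambda>j. t * c j) (\<lambda>j. t * d j) u (int n))
      \<le> K * (norm (\<Prod>j=1..4. c j) * norm q powi (-3 - e)) ^ n" .
  qed
qed

end

text \<open>Up to normalisation a term of the very well poised 6psi6 series. The factorials at m =
  0, usually divided out, are left in place: every term is then free of denominators and holomorphic
  for nonzero u.\<close>

definition vwp_term :: "complex \<Rightarrow> (nat \<Rightarrow> complex) \<Rightarrow> complex \<Rightarrow> int \<Rightarrow> complex" where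
  "vwp_term q x u m = psi_term q 0 (\<lambda>j. q * x j) (\<lambda>j. q * x j) u m
                    - psi_term q (-2) (\<lambda>j. q * x j) (\<lambda>j. q * x j) u m"

definition vwp_sum :: "complex \<Rightarrow> (nat \<Rightarrow> complex) \<Rightarrow> complex \<Rightarrow> complex" where
  "vwp_sum q x u = (\<Sum>\<^sub>\<infinity>m. vwp_term q x u m)"

lemma summable_on_power_nat_abs:
  fixes \<rho> :: real
  assumes "0 \<le> \<rho>" "\<rho> < 1"
  shows "(\<lambda>m::int. \<rho> ^ nat \<bar>m\<bar>) summable_on UNIV"
proof -
  have 1: "(\<lambda>n. \<rho> ^ n) summable_on UNIV" "(\<lambda>n. \<rho> ^ Suc n) summable_on UNIV"
    using assms
    by (auto intro!: norm_summable_imp_summable_on summable_mult summable_geometric simp: norm_mult norm_power)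
  have "(\<lambda>m::int. \<rho> ^ nat \<bar>m\<bar>) summable_on range int"
    using 1(1) by (subst summable_on_reindex) (auto simp: o_def)
  moreover have "(\<lambda>m::int. \<rho> ^ nat \<bar>m\<bar>) summable_on range (\<lambda>n. - int (Suc n))"
    using 1(2) by (subst summable_on_reindex) (auto simp: o_def inj_on_def nat_add_distrib add_ac)
  ultimately have "(\<lambda>m::int. \<rho> ^ nat \<bar>m\<bar>) summable_on (range int \<union> range (\<lambda>n. - int (Suc n)))"
    by (rule summable_on_Un_disjoint) auto
  also have "range int \<union> range (\<lambda>n. - int (Suc n)) = UNIV"
    by (metis (no_types, lifting) UNIV_eq_I UnI1 UnI2 int_cases rangeI)
  finally show ?thesis .
qed

lemma prod_atLeast1_atMost4: "(\<Prod>i=1..4::nat. f i) = f 1 * f 2 * f 3 * (f 4 :: complex)"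
  by (simp add: eval_nat_numeral atLeastAtMostSuc_conv mult_ac)

lemma prod_pairs_1_4:
  "(\<Prod>i=1..4::nat. \<Prod>k=i+1..4. g i k) = g 1 2 * g 1 3 * g 1 4 * g 2 3 * g 2 4 * (g 3 4 :: complex)"
proof -
  have "{2..4::nat} = {2,3,4}" "{Suc (Suc 0)..4} = {2,3,4}" "{3..4::nat} = {3,4}" "{5..4::nat} = {}" by auto
  then show ?thesis
    unfolding prod_atLeast1_atMost4 by (simp add: mult.assoc)
qed

text \<open>The recurrences single out one parameter. Listing the other three explicitly, and
  splitting symmetric products over pairs accordingly, replaces a reduction to j = 1 by
  symmetry.\<close>

lemma prod_1_4_split:
  fixes j :: nat
  assumes "j \<in> {1..4}"
  obtains k1 k2 k3 where "{1..4} - {j} = {k1, k2, k3}" "distinct [j, k1, k2, k3]"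
    "\<And>f :: nat \<Rightarrow> complex. (\<Prod>i=1..4. f i) = f j * f k1 * f k2 * f k3"
    "\<And>g :: nat \<Rightarrow> nat \<Rightarrow> complex. (\<And>i k. g i k = g k i) \<Longrightarrow>
       (\<Prod>i=1..4. \<Prod>k=i+1..4. g i k) = g j k1 * g j k2 * g j k3 * (g k1 k2 * g k1 k3 * g k2 k3)"
proof -
  from assms consider "j = 1" | "j = 2" | "j = 3" | "j = 4" by force
  then show thesis
  proof cases
    case 1
    show thesis
    proof (rule that [of 2 3 4])
      show "{1..4} - {j} = {2, 3, 4}" using 1 by auto
      fix g :: "nat \<Rightarrow> nat \<Rightarrow> complex"
      show "(\<Prod>i=1..4. \<Prod>k=i+1..4. g i k) = g j 2 * g j 3 * g j 4 * (g 2 3 * g 2 4 * g 3 4)"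
        unfolding prod_pairs_1_4 1 by simp
    qed (unfold prod_atLeast1_atMost4, simp_all add: 1)
  next
    case 2
    show thesis
    proof (rule that [of 1 3 4])
      show "{1..4} - {j} = {1, 3, 4}" using 2 by auto
      fix g :: "nat \<Rightarrow> nat \<Rightarrow> complex" assume "\<And>i k. g i k = g k i"
      then have "g 2 1 = g 1 2" by blast
      then show "(\<Prod>i=1..4. \<Prod>k=i+1..4. g i k) = g j 1 * g j 3 * g j 4 * (g 1 3 * g 1 4 * g 3 4)"
        unfolding prod_pairs_1_4 2 by simp
    qed (unfold prod_atLeast1_atMost4, simp_all add: 2)
  next
    case 3
    show thesis
    proof (rule that [of 1 2 4])
      show "{1..4} - {j} = {1, 2, 4}" using 3 by auto
      fix g :: "nat \<Rightarrow> nat \<Rightarrow> complex" assume "\<And>i k. g i k = g k i"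
      then have "g 3 1 = g 1 3" "g 3 2 = g 2 3" by blast+
      then show "(\<Prod>i=1..4. \<Prod>k=i+1..4. g i k) = g j 1 * g j 2 * g j 4 * (g 1 2 * g 1 4 * g 2 4)"
        unfolding prod_pairs_1_4 3 by simp
    qed (unfold prod_atLeast1_atMost4, simp_all add: 3)
  next
    case 4
    show thesis
    proof (rule that [of 1 2 3])
      show "{1..4} - {j} = {1, 2, 3}" using 4 by auto
      fix g :: "nat \<Rightarrow> nat \<Rightarrow> complex" assume "\<And>i k. g i k = g k i"
      then have "g 4 1 = g 1 4" "g 4 2 = g 2 4" "g 4 3 = g 3 4" by blast+
      then show "(\<Prod>i=1..4. \<Prod>k=i+1..4. g i k) = g j 1 * g j 2 * g j 3 * (g 1 2 * g 1 3 * g 2 3)"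
        unfolding prod_pairs_1_4 4 by simp
    qed (unfold prod_atLeast1_atMost4, simp_all add: 4)
  qed
qed

text \<open>After division by v both sides are odd under v -> 1/v and have degree at most 2 in v and
  in 1/v, so only the coefficients of v^2 and v have to agree. They are b (1 - b b2 b3 b4) and b (e3
  - e1), with e1, e3 the elementary symmetric functions of b, b2, b3, b4.\<close>

lemma beta_identity:
  fixes v :: complex
  assumes "v \<noteq> 0"
  shows "((1 - b * b2) * (1 - b * b3) * (1 - b * b4) - (1 - b * b2 * b3 * b4) * ((1 - b * v) * (1 - b / v))) * (v^2 - 1)
     = b * v^3 * ((1 - b / v) * (1 - b2 / v) * (1 - b3 / v) * (1 - b4 / v))
       - b / v * ((1 - b * v) * (1 - b2 * v) * (1 - b3 * v) * (1 - b4 * v))"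
proof -
  have *: "(1 - y / v) = (v - y) / v" for y
    using assms by (simp add: field_simps)
  have 1: "((1 - b * b2) * (1 - b * b3) * (1 - b * b4) * v - (1 - b * b2 * b3 * b4) * ((1 - b * v) * (v - b))) * (v^2 - 1)
     = b * ((v - b) * (v - b2) * (v - b3) * (v - b4)) - b * ((1 - b * v) * (1 - b2 * v) * (1 - b3 * v) * (1 - b4 * v))"
    by (simp add: algebra_simps power2_eq_square)
  have 2: "(X - C * (Y * (D / v))) * Z = b * v^3 * (E1 / v * (E2 / v) * (E3 / v) * (E4 / v)) - b / v * F"
    if "(X * v - C * (Y * D)) * Z = b * (E1 * E2 * E3 * E4) - b * F" for X C Y D Z E1 E2 E3 E4 F
  proof -
    have "(X - C * (Y * (D / v))) * Z = ((X * v - C * (Y * D)) * Z) / v"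
      using assms by (simp add: field_simps)
    also have "\<dots> = b * v^3 * (E1 / v * (E2 / v) * (E3 / v) * (E4 / v)) - b / v * F"
      unfolding that using assms by (simp add: field_simps eval_nat_numeral)
    finally show ?thesis .
  qed
  show ?thesis
    unfolding * by (rule 2) (rule 1)
qed

context
  fixes q :: complex
  assumes q: "0 < norm q" "norm q < 1"
begin

text \<open>The two bounds by \<open>\<rho>\<close> concern the geometric ratios in the two
  directions: exponent -3 - e for m >= 0, and -3 - (-2 - e) = e - 1 after reflection, which also
  puts d in the place of c. One majorant serves M-tests in u as well as in t.\<close>

lemma psi_term_bound:
  assumes r: "0 < r" "r \<le> R" and cd: "\<And>j. j \<in> {1..4} \<Longrightarrow> c j \<noteq> 0 \<and> d j \<noteq> 0"
    and \<rho>: "norm (\<Prod>j=1..4. c j) * norm q powi (-3 - e) \<le> \<rho>"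
            "norm (\<Prod>j=1..4. d j) * norm q powi (e - 1) \<le> \<rho>" "\<rho> < 1"
  obtains M where "M summable_on UNIV" "\<And>m u t. r \<le> norm u \<Longrightarrow> norm u \<le> R \<Longrightarrow> norm t \<le> 1 \<Longrightarrow>
    norm (psi_term q e (\<lambda>j. t * c j) (\<lambda>j. t * d j) u m) \<le> M m"
proof -
  have \<rho>0: "0 \<le> \<rho>"
    by (rule order_trans [OF _ \<rho>(1)]) auto
  obtain K1 where K1: "0 \<le> K1"
    "\<And>n u t. r \<le> norm u \<Longrightarrow> norm u \<le> R \<Longrightarrow> norm t \<le> 1 \<Longrightarrow>
      norm (psi_term q e (\<lambda>j. t * c j) (\<lambda>j. t * d j) u (int n))
      \<le> K1 * (norm (\<Prod>j=1..4. c j) * norm q powi (-3 - e)) ^ n"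
    by (rule psi_term_nonneg_bound [OF q r, of c e d]; (use cd in blast)?; (rule that; assumption)?)
  have rR: "0 < 1 / R" "1 / R \<le> 1 / r" using r by (auto simp: divide_simps)
  have \<rho>e: "-3 - (-2 - e) = e - 1" by simp
  obtain K2 where K2: "0 \<le> K2"
    "\<And>n u t. 1 / R \<le> norm u \<Longrightarrow> norm u \<le> 1 / r \<Longrightarrow> norm t \<le> 1 \<Longrightarrow>
      norm (psi_term q (-2 - e) (\<lambda>j. t * d j) (\<lambda>j. t * c j) u (int n))
      \<le> K2 * (norm (\<Prod>j=1..4. d j) * norm q powi (e - 1)) ^ n"
    by (rule psi_term_nonneg_bound [OF q rR, of d "-2 - e" c, unfolded \<rho>e]; (use cd in blast)?; (rule that; assumption)?)
  have K2': "norm (psi_term q e (\<lambda>j. t * c j) (\<lambda>j. t * d j) u (- int n)) \<le> K2 / r^2 * \<rho> ^ n"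
    if "r \<le> norm u" "norm u \<le> R" "norm t \<le> 1" for n u t
  proof -
    have u: "u \<noteq> 0" using that r by auto
    then have "norm (psi_term q e (\<lambda>j. t * c j) (\<lambda>j. t * d j) u (- int n)) =
      (1 / norm u) ^ 2 * norm (psi_term q (-2 - e) (\<lambda>j. t * d j) (\<lambda>j. t * c j) (1/u) (int n))"
      by (subst psi_term_uminus [OF q]) (simp_all add: norm_mult norm_power norm_divide)
    also have "\<dots> \<le> (1 / r) ^ 2 * (K2 * \<rho> ^ n)"
    proof (intro mult_mono power_mono)
      have "norm (psi_term q (-2 - e) (\<lambda>j. t * d j) (\<lambda>j. t * c j) (1/u) (int n))
        \<le> K2 * (norm (\<Prod>j=1..4. d j) * norm q powi (e - 1)) ^ n"
        using that r u by (intro K2(2)) (auto simp: norm_divide intro!: divide_left_mono)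
      also have "\<dots> \<le> K2 * \<rho> ^ n"
        using K2(1) \<rho> by (intro mult_left_mono power_mono) auto
      finally show "norm (psi_term q (-2 - e) (\<lambda>j. t * d j) (\<lambda>j. t * c j) (1/u) (int n)) \<le> K2 * \<rho> ^ n" .
    qed (use that r u in \<open>auto intro!: divide_left_mono\<close>)
    finally show ?thesis by (simp add: power_divide)
  qed
  have K1': "norm (psi_term q e (\<lambda>j. t * c j) (\<lambda>j. t * d j) u (int n)) \<le> K1 * \<rho> ^ n"
    if "r \<le> norm u" "norm u \<le> R" "norm t \<le> 1" for n u t
    by (rule order_trans [OF K1(2) [OF that]]) (use K1(1) \<rho> in \<open>auto intro!: mult_left_mono power_mono\<close>)
  show thesis
  proof
    show "(\<lambda>m. (K1 + K2 / r^2) * \<rho> ^ nat \<bar>m\<bar>) summable_on UNIV"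
      using \<rho>0 \<rho>(3) by (intro summable_on_cmult_right summable_on_power_nat_abs)
    fix m :: int and u t :: complex
    assume *: "r \<le> norm u" "norm u \<le> R" "norm t \<le> 1"
    obtain n where "m = int n \<or> m = - int n" by (metis int_cases2)
    then show "norm (psi_term q e (\<lambda>j. t * c j) (\<lambda>j. t * d j) u m) \<le> (K1 + K2 / r^2) * \<rho> ^ nat \<bar>m\<bar>"
    proof
      assume "m = int n"
      moreover have "K1 * \<rho> ^ n \<le> (K1 + K2 / r^2) * \<rho> ^ n"
        using K1(1) K2(1) \<rho>0 r by (intro mult_right_mono) auto
      ultimately show ?thesis using K1' [OF *, of n] by simp
    next
      assume "m = - int n"
      moreover have "K2 / r^2 * \<rho> ^ n \<le> (K1 + K2 / r^2) * \<rho> ^ n"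
        using K1(1) K2(1) \<rho>0 r by (intro mult_right_mono) auto
      ultimately show ?thesis using K2' [OF *, of n] by simp
    qed
  qed
qed

text \<open>In the local variable v, passing from m to m - 1 replaces v by q v and multiplies the
  Gaussian factor w by q^3 v^4. Telescoping thereby becomes an identity in v alone, with w as a
  common factor.\<close>

lemma psi_term_alt:
  assumes u: "u \<noteq> 0" and v: "v = u * q powi (-m)" and w: "w = q powi (2*m*m - m) * u powi (-4*m)"
  shows "psi_term q e c d u m = v powi e * (\<Prod>j=1..4. qpoch_inf (c j * v) q * qpoch_inf (d j / v) q) * w"
    and "psi_term q e c d u (m - 1) =
      (q * v) powi e * (\<Prod>j=1..4. qpoch_inf (c j * (q * v)) q * qpoch_inf (d j / (q * v)) q) * (q ^ 3 * v ^ 4 * w)"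
proof -
  have q0 [simp]: "q \<noteq> 0" using q by auto
  have *: "psi_term q e c d u m =
      v powi e * (\<Prod>j=1..4. qpoch_inf (c j * v) q * qpoch_inf (d j / v) q) * (q powi (2*m*m - m) * u powi (-4*m))"
    if "v = u * q powi (-m)" for v m
  proof -
    have "c j * u * q powi (-m) = c j * v" "d j * q powi m / u = d j / v" for j
      using u that by (auto simp: power_int_minus field_simps)
    then show ?thesis
      using that by (simp only: psi_term_def)
  qed
  show "psi_term q e c d u m = v powi e * (\<Prod>j=1..4. qpoch_inf (c j * v) q * qpoch_inf (d j / v) q) * w"
    using * [OF v] w by simp
  have "q * v = u * q powi (-(m - 1))"
    by (simp add: v power_int_minus power_int_diff field_simps)
  moreover have "q powi (2*(m-1)*(m-1) - (m-1)) * u powi (-4*(m-1)) = q ^ 3 * v ^ 4 * w"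
  proof -
    have "2*(m-1)*(m-1) - (m-1) = (2*m*m - m) + (-4*m) + 3" "-4*(m-1) = -4*m + 4"
      by (simp_all add: algebra_simps)
    then have "q powi (2*(m-1)*(m-1) - (m-1)) = q powi (2*m*m - m) * q powi (-4*m) * q ^ 3"
      "u powi (-4*(m-1)) = u powi (-4*m) * u ^ 4"
      using assms by (simp_all only: power_int_add [of q] power_int_add [of u] q0 simp_thms) simp_all
    moreover have "v ^ 4 = u ^ 4 * q powi (-4*m)"
      by (simp add: v power_mult_distrib mult.commute power_int_power')
    ultimately show ?thesis
      by (simp add: w)
  qed
  ultimately show "psi_term q e c d u (m - 1) =
      (q * v) powi e * (\<Prod>j=1..4. qpoch_inf (c j * (q * v)) q * qpoch_inf (d j / (q * v)) q) * (q ^ 3 * v ^ 4 * w)"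
    using * [of "q * v" "m - 1"] by simp
qed

end

section \<open>Telescoping and the descent to vanishing parameters\<close>

context
  fixes q :: complex
  assumes q: "0 < norm q" "norm q < 1"
begin

text \<open>The two families of \<open>T\<close> differ by a factor q. At index m the first one, x',
  has surplus factors 1 - x'_i v over the families q x'; at index m - 1, where v becomes q v, it
  turns into q x' and the surplus 1 - x'_i / v moves to the second. These are the two products on
  the right of \<open>beta_identity\<close>, taken with b = q x_j and the three other x_k.\<close>

lemma vwp_term_telescope:
  fixes x :: "nat \<Rightarrow> complex"
  assumes u: "u \<noteq> 0" and j: "j \<in> {1..4}"
  defines "x' \<equiv> x(j := q * x j)"
  defines "T \<equiv> (\<lambda>m. - (q * x j) * psi_term q (-3) x' (\<lambda>i. q * x' i) u m)"
  shows "(\<Prod>k\<in>{1..4}-{j}. 1 - q * (x j * x k)) * vwp_term q x' u m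
      - (1 - q * (\<Prod>k=1..4. x k)) * vwp_term q x u m = T m - T (m - 1)"
proof -
  have q0 [simp]: "q \<noteq> 0" using q by auto
  define v where "v = u * q powi (-m)"
  define w where "w = q powi (2*m*m - m) * u powi (-4*m)"
  have v0 [simp]: "v \<noteq> 0" using u by (simp add: v_def)
  note psi = psi_term_alt [OF q u v_def w_def]
  obtain k1 k2 k3 where k: "{1..4} - {j} = {k1, k2, k3}" "distinct [j, k1, k2, k3]"
    and p: "\<And>f :: nat \<Rightarrow> complex. (\<Prod>i=1..4. f i) = f j * f k1 * f k2 * f k3"
  proof (rule prod_1_4_split [OF j])
    fix k1 k2 k3
    assume *: "{1..4} - {j} = {k1, k2, k3}" "distinct [j, k1, k2, k3]"
      "\<And>f :: nat \<Rightarrow> complex. (\<Prod>i=1..4. f i) = f j * f k1 * f k2 * f k3"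
    show thesis by (rule that [OF *])
  qed
  define P where "P = (\<lambda>a. qpoch_inf a q)"
  have P: "qpoch_inf a q = P a" for a by (simp add: P_def)
  have P1: "P y = (1 - y) * P (q * y)" for y
    unfolding P_def by (rule qpoch_inf_rec [OF q])
  have x' [simp]: "x' j = q * x j" "x' k1 = x k1" "x' k2 = x k2" "x' k3 = x k3"
    using k by (auto simp: x'_def)
  \<comment> \<open>The factorials of the term for \<open>x'\<close>, together with w; all four
    expressions below are \<open>A\<close> times elementary factors.\<close>
  define A where "A = P (q * (q * x j * v)) * P (q * (q * x j / v)) * (P (q * x k1 * v) * P (q * x k1 / v))
    * (P (q * x k2 * v) * P (q * x k2 / v)) * (P (q * x k3 * v) * P (q * x k3 / v)) * w"
  have 1: "psi_term q e (\<lambda>i. q * x' i) (\<lambda>i. q * x' i) u m = v powi e * A" for e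
    unfolding psi p A_def x' P by (simp only: mult_ac times_divide_eq_right)
  have 2: "psi_term q e (\<lambda>i. q * x i) (\<lambda>i. q * x i) u m = v powi e * ((1 - q * x j * v) * (1 - q * x j / v) * A)" for e
    unfolding psi p A_def P P1 [of "q * x j * v"] P1 [of "q * x j / v"]
    by (simp only: mult_ac times_divide_eq_right)
  have 3: "T m = - (q * x j) * (v powi (-3) * ((1 - q * x j * v) * (1 - x k1 * v) * (1 - x k2 * v) * (1 - x k3 * v) * A))"
    unfolding T_def psi p x' A_def P
      P1 [of "q * x j * v"] P1 [of "x k1 * v"] P1 [of "x k2 * v"] P1 [of "x k3 * v"]
    by (simp only: mult_ac times_divide_eq_right)
  have 4: "T (m - 1) = - (q * x j) * ((q * v) powi (-3) * (q ^ 3 * v ^ 4) *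
      ((1 - q * x j / v) * (1 - x k1 / v) * (1 - x k2 / v) * (1 - x k3 / v) * A))"
  proof -
    have "q * y / (q * v) = y / v" "y * (q * v) = q * y * v" "q * (y / v) = q * y / v" for y
      by simp_all
    note * = this
    show ?thesis
      unfolding T_def psi p x' A_def P *
        P1 [of "q * x j / v"] P1 [of "x k1 / v"] P1 [of "x k2 / v"] P1 [of "x k3 / v"]
      by (simp only: mult_ac times_divide_eq_right)
  qed
  have 5: "(\<Prod>k\<in>{1..4}-{j}. 1 - q * (x j * x k)) =
      (1 - q * x j * x k1) * (1 - q * x j * x k2) * (1 - q * x j * x k3)"
    unfolding k(1) using k(2) by (simp add: mult_ac)
  \<comment> \<open>The exponent -3 in \<open>T\<close> is chosen to produce the prefactors v^(-3)
    and v: these are b/v and b v^3 of \<open>beta_identity\<close>, divided by b v^2.\<close>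
  have 6: "(q * v) powi (-3) * (q ^ 3 * v ^ 4) = v" "v powi 0 - v powi (-2) = (v^2 - 1) / v^2"
    "v powi (-3) = 1 / v^3"
    by (simp_all add: power_int_minus field_simps eval_nat_numeral)
  let ?B = "((1 - q * x j * v) * (1 - x k1 * v) * (1 - x k2 * v) * (1 - x k3 * v))"
  let ?C = "((1 - q * x j / v) * (1 - x k1 / v) * (1 - x k2 / v) * (1 - x k3 / v))"
  let ?D = "(1 - q * x j * x k1) * (1 - q * x j * x k2) * (1 - q * x j * x k3)
       - (1 - q * x j * x k1 * x k2 * x k3) * ((1 - q * x j * v) * (1 - q * x j / v))"
  have "(\<Prod>k\<in>{1..4}-{j}. 1 - q * (x j * x k)) * vwp_term q x' u m
      - (1 - q * (\<Prod>k=1..4. x k)) * vwp_term q x u m = ?D * (v powi 0 - v powi (-2)) * A"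
    unfolding vwp_term_def 1 2 5 p by (simp only: algebra_simps)
  also have "\<dots> = (?D * (v^2 - 1)) / v^2 * A"
    unfolding 6 by simp
  also have "?D * (v^2 - 1) = q * x j * v^3 * ?C - q * x j / v * ?B"
    by (rule beta_identity) simp
  also have "(q * x j * v^3 * ?C - q * x j / v * ?B) / v^2 * A = T m - T (m - 1)"
  proof -
    have "(X * v^3 * Y - X / v * Z) / v^2 * A = - X * (1 / v^3 * (Z * A)) - (- X * (v * (Y * A)))" for X Y Z
      by (simp add: field_simps eval_nat_numeral)
    then show ?thesis unfolding 3 4 6 .
  qed
  finally show ?thesis .
qed

end

lemma has_sum_diff:
  fixes f g :: "'a \<Rightarrow> complex"
  assumes "(f has_sum a) A" "(g has_sum b) A"
  shows "((\<lambda>x. f x - g x) has_sum (a - b)) A"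
  using has_sum_add [OF assms(1) has_sum_uminusI [OF assms(2)]] by simp

text \<open>After any number of steps X and Y have picked up the same factor r, which
  cross-multiplication eliminates without dividing; vanishing factors therefore do no harm and their
  infinite product is never formed. \<open>Q\<close> carries the domain on which a step is
  legitimate. The congruence condition reconciles the steps, which alter only indices 1 to 4, with
  the limit, which scales every index.\<close>

lemma scaling_recurrence:
  fixes X Y :: "(nat \<Rightarrow> complex) \<Rightarrow> complex" and q :: complex
  assumes step: "\<And>y j. Q y \<Longrightarrow> j \<in> {1..4} \<Longrightarrow> Q (y(j := q * y j)) \<and>
      (\<exists>r. X y = r * X (y(j := q * y j)) \<and> Y y = r * Y (y(j := q * y j)))"
    and cong: "\<And>y z. (\<And>j. j \<in> {1..4} \<Longrightarrow> y j = z j) \<Longrightarrow> X y = X z \<and> Y y = Y z"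
    and lim: "(\<lambda>N. X (\<lambda>j. q ^ N * y j)) \<longlonglongrightarrow> LX" "(\<lambda>N. Y (\<lambda>j. q ^ N * y j)) \<longlonglongrightarrow> LY"
    and y: "Q y"
  shows "X y * LY = Y y * LX"
proof -
  define rel where "rel y z \<longleftrightarrow> Q z \<and> (\<exists>r. X y = r * X z \<and> Y y = r * Y z)" for y z
  have trans: "rel y1 y3" if "rel y1 y2" "rel y2 y3" for y1 y2 y3
    using that unfolding rel_def by (metis mult.assoc)
  have one: "rel z (z(j := q * z j))" if "Q z" "j \<in> {1..4}" for z j
    using step that by (auto simp: rel_def)
  have "\<exists>z. (\<forall>j\<in>{1..4}. z j = q ^ N * y j) \<and> rel y z" for N
  proof (induction N)
    case 0
    then show ?case using y by (auto simp: rel_def intro!: exI [of _ y] exI [of _ 1])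
  next
    case (Suc N)
    then obtain z where z: "\<forall>j\<in>{1..4}. z j = q ^ N * y j" "rel y z" by auto
    have rs: "rel y (z'(j := q * z' j))" if "rel y z'" "j \<in> {1..4}" for z' j
      using trans [OF that(1) one [OF _ that(2)]] that(1) by (auto simp: rel_def)
    \<comment> \<open>Four steps, one for each index, lead from q^N y to q^(N+1) y.\<close>
    define z1 where "z1 = z(1 := q * z 1)"
    define z2 where "z2 = z1(2 := q * z1 2)"
    define z3 where "z3 = z2(3 := q * z2 3)"
    define z4 where "z4 = z3(4 := q * z3 4)"
    have "rel y z4"
      unfolding z4_def z3_def z2_def z1_def by (intro rs z(2)) auto
    moreover have "\<forall>j\<in>{1..4}. z4 j = q ^ Suc N * y j"
    proof
      fix j :: nat assume "j \<in> {1..4}"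
      then have "j = 1 \<or> j = 2 \<or> j = 3 \<or> j = 4" by auto
      then show "z4 j = q ^ Suc N * y j"
        using z(1) by (auto simp: z4_def z3_def z2_def z1_def)
    qed
    ultimately show ?case by blast
  qed
  then have *: "X y * Y (\<lambda>j. q ^ N * y j) = Y y * X (\<lambda>j. q ^ N * y j)" for N
  proof -
    obtain z where z: "\<forall>j\<in>{1..4}. z j = q ^ N * y j" "rel y z"
      using \<open>\<And>N. \<exists>z. (\<forall>j\<in>{1..4}. z j = q ^ N * y j) \<and> rel y z\<close> by blast
    then have "X z = X (\<lambda>j. q ^ N * y j)" "Y z = Y (\<lambda>j. q ^ N * y j)"
      using cong [of z "\<lambda>j. q ^ N * y j"] by auto
    then show ?thesis
      using z(2) unfolding rel_def by (metis mult.assoc mult.commute)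
  qed
  have "(\<lambda>N. X y * Y (\<lambda>j. q ^ N * y j)) \<longlonglongrightarrow> X y * LY" "(\<lambda>N. Y y * X (\<lambda>j. q ^ N * y j)) \<longlonglongrightarrow> Y y * LX"
    by (intro tendsto_intros lim)+
  then show ?thesis
    unfolding * by (rule LIMSEQ_unique)
qed

section \<open>Convergence and recurrence of the very well poised series\<close>

context
  fixes q :: complex
  assumes q: "0 < norm q" "norm q < 1"
begin

text \<open>With \<open>\<rho>\<close> = |q x_1 x_2 x_3 x_4|, the exponents e = 0 and e = -2 have
  ratios \<open>\<rho>\<close> and |q|^2 \<open>\<rho>\<close> in the two directions, in opposite
  order. The convergence condition thus handles both.\<close>

lemma vwp_term_bound:
  assumes r: "0 < r" "r \<le> R" and x: "\<And>j. j \<in> {1..4} \<Longrightarrow> x j \<noteq> 0"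
    and conv: "norm (q * (\<Prod>j=1..4. x j)) < 1"
  obtains M where "M summable_on UNIV" "\<And>m u t. r \<le> norm u \<Longrightarrow> norm u \<le> R \<Longrightarrow> norm t \<le> 1 \<Longrightarrow>
    norm (vwp_term q (\<lambda>j. t * x j) u m) \<le> M m"
proof -
  have q0: "q \<noteq> 0" using q by auto
  define \<rho> where "\<rho> = norm (q * (\<Prod>j=1..4. x j))"
  have P: "norm (\<Prod>j=1..4. q * x j) = norm q ^ 3 * \<rho>"
    by (simp add: prod.distrib norm_mult norm_power \<rho>_def eval_nat_numeral)
  have \<rho>0: "0 \<le> \<rho>" "\<rho> < 1" using conv by (auto simp: \<rho>_def)
  have a: "norm (\<Prod>j=1..4. q * x j) * norm q powi (-3) \<le> \<rho>"
    unfolding P using q0 by (simp add: power_int_minus field_simps)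
  have "norm q ^ 3 * \<rho> * norm q powi (-1) = norm q ^ 2 * \<rho>"
    using q0 by (simp add: power_int_minus eval_nat_numeral)
  also have "\<dots> \<le> \<rho>"
    using q \<rho>0 by (intro mult_left_le_one_le) (auto simp: power_le_one)
  finally have b: "norm (\<Prod>j=1..4. q * x j) * norm q powi (-1) \<le> \<rho>"
    unfolding P .
  have cd: "q * x j \<noteq> 0 \<and> q * x j \<noteq> 0" if "j \<in> {1..4}" for j
    using x [OF that] q0 by simp
  obtain M1 where M1: "M1 summable_on UNIV" "\<And>m u t. r \<le> norm u \<Longrightarrow> norm u \<le> R \<Longrightarrow> norm t \<le> 1 \<Longrightarrow>
    norm (psi_term q 0 (\<lambda>j. t * (q * x j)) (\<lambda>j. t * (q * x j)) u m) \<le> M1 m"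
  proof (rule psi_term_bound [OF q r cd, where e = 0 and \<rho> = \<rho>])
    fix M assume *: "M summable_on UNIV" "\<And>m u t. r \<le> norm u \<Longrightarrow> norm u \<le> R \<Longrightarrow> norm t \<le> 1 \<Longrightarrow>
    norm (psi_term q 0 (\<lambda>j. t * (q * x j)) (\<lambda>j. t * (q * x j)) u m) \<le> M m"
    show thesis by (rule that [OF *])
  qed (use a b \<rho>0 in simp_all)
  obtain M2 where M2: "M2 summable_on UNIV" "\<And>m u t. r \<le> norm u \<Longrightarrow> norm u \<le> R \<Longrightarrow> norm t \<le> 1 \<Longrightarrow>
    norm (psi_term q (-2) (\<lambda>j. t * (q * x j)) (\<lambda>j. t * (q * x j)) u m) \<le> M2 m"
  proof (rule psi_term_bound [OF q r cd, where e = "-2" and \<rho> = \<rho>])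
    fix M assume *: "M summable_on UNIV" "\<And>m u t. r \<le> norm u \<Longrightarrow> norm u \<le> R \<Longrightarrow> norm t \<le> 1 \<Longrightarrow>
    norm (psi_term q (-2) (\<lambda>j. t * (q * x j)) (\<lambda>j. t * (q * x j)) u m) \<le> M m"
    show thesis by (rule that [OF *])
  qed (use a b \<rho>0 in simp_all)
  show thesis
  proof
    show "(\<lambda>m. M1 m + M2 m) summable_on UNIV"
      by (intro summable_on_add M1 M2)
    fix m :: int and u t :: complex
    assume *: "r \<le> norm u" "norm u \<le> R" "norm t \<le> 1"
    show "norm (vwp_term q (\<lambda>j. t * x j) u m) \<le> M1 m + M2 m"
      unfolding vwp_term_def using M1(2) [OF *, of m] M2(2) [OF *, of m]
      by (intro order_trans [OF norm_triangle_ineq4] add_mono) (simp_all add: mult.left_commute)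
  qed
qed

lemma vwp_term_summable:
  assumes "u \<noteq> 0" "norm t \<le> 1" and x: "\<And>j. j \<in> {1..4} \<Longrightarrow> x j \<noteq> 0"
    and conv: "norm (q * (\<Prod>j=1..4. x j)) < 1"
  shows "(\<lambda>m. vwp_term q (\<lambda>j. t * x j) u m) summable_on UNIV"
proof -
  have u: "0 < norm u" using assms by simp
  obtain M where M: "M summable_on UNIV" "\<And>m v t. norm u \<le> norm v \<Longrightarrow> norm v \<le> norm u \<Longrightarrow> norm t \<le> 1 \<Longrightarrow>
    norm (vwp_term q (\<lambda>j. t * x j) v m) \<le> M m"
  proof (rule vwp_term_bound [OF u order_refl x conv])
    fix M assume *: "M summable_on UNIV" "\<And>m v t. norm u \<le> norm v \<Longrightarrow> norm v \<le> norm u \<Longrightarrow> norm t \<le> 1 \<Longrightarrow>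
      norm (vwp_term q (\<lambda>j. t * x j) v m) \<le> M m"
    show thesis by (rule that [OF *])
  qed
  show ?thesis
    using M(1) M(2) [OF order_refl order_refl assms(2)]
    by (rule abs_summable_summable [OF Infinite_Sum.abs_summable_on_comparison_test' [of M]])
qed

text \<open>The telescoped sum vanishes because \<open>T\<close> is itself summable: for e = -3 and
  the families x', q x' the ratios in both directions are |q x_1 x_2 x_3 x_4|, so the same
  convergence condition applies.\<close>

lemma vwp_sum_recurrence:
  assumes u: "u \<noteq> 0" and x: "\<And>j. j \<in> {1..4} \<Longrightarrow> x j \<noteq> 0"
    and conv: "norm (q * (\<Prod>j=1..4. x j)) < 1" and j: "j \<in> {1..4}"
  shows "(1 - q * (\<Prod>k=1..4. x k)) * vwp_sum q x u =
    (\<Prod>k\<in>{1..4}-{j}. 1 - q * (x j * x k)) * vwp_sum q (x(j := q * x j)) u"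
proof -
  have q0: "q \<noteq> 0" using q by auto
  let ?x' = "x(j := q * x j)"
  define T where "T = (\<lambda>m. - (q * x j) * psi_term q (-3) ?x' (\<lambda>i. q * ?x' i) u m)"
  have P': "(\<Prod>k=1..4. ?x' k) = q * (\<Prod>k=1..4. x k)"
    using j by (simp add: prod.remove [of _ j])
  have x': "?x' k \<noteq> 0" if "k \<in> {1..4}" for k using x [OF that] q0 by auto
  obtain M where M: "M summable_on UNIV" "\<And>m v t. norm u \<le> norm v \<Longrightarrow> norm v \<le> norm u \<Longrightarrow> norm t \<le> 1 \<Longrightarrow>
    norm (psi_term q (-3) (\<lambda>i. t * ?x' i) (\<lambda>i. t * (q * ?x' i)) v m) \<le> M m"
  proof (rule psi_term_bound [OF q, of "norm u" "norm u" ?x' "\<lambda>i. q * ?x' i" "-3" "norm (q * (\<Prod>j=1..4. x j))"])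
    fix M assume *: "M summable_on UNIV" "\<And>m v t. norm u \<le> norm v \<Longrightarrow> norm v \<le> norm u \<Longrightarrow> norm t \<le> 1 \<Longrightarrow>
      norm (psi_term q (-3) (\<lambda>i. t * ?x' i) (\<lambda>i. t * (q * ?x' i)) v m) \<le> M m"
    show thesis by (rule that [OF *])
  next
    show "norm (prod ?x' {1..4}) * norm q powi (-3 - (-3)) \<le> norm (q * (\<Prod>j=1..4. x j))"
      unfolding P' by simp
    have "norm (\<Prod>k=1..4. q * ?x' k) = norm q ^ 4 * norm (q * (\<Prod>j=1..4. x j))"
      unfolding prod.distrib P' by (simp add: norm_mult norm_power)
    then show "norm (\<Prod>k=1..4. q * ?x' k) * norm q powi (-3 - 1) \<le> norm (q * (\<Prod>j=1..4. x j))"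
      using q0 by (simp add: power_int_minus field_simps del: fun_upd_apply)
  qed (use u x' q0 conv in auto)
  have T: "T summable_on UNIV"
  proof -
    have "(\<lambda>m. psi_term q (-3) ?x' (\<lambda>i. q * ?x' i) u m) summable_on UNIV"
    proof (rule abs_summable_summable [OF Infinite_Sum.abs_summable_on_comparison_test' [of M]])
      show "norm (psi_term q (-3) ?x' (\<lambda>i. q * ?x' i) u m) \<le> M m" for m
        using M(2) [of u 1 m] by (simp del: fun_upd_apply)
    qed (rule M(1))
    then show ?thesis unfolding T_def by (rule summable_on_cmult_right)
  qed
  have bij: "bij_betw (\<lambda>m::int. m - 1) UNIV UNIV"
    by (rule bij_betwI [of _ _ _ "\<lambda>m. m + 1"]) auto
  have T': "(\<lambda>m. T (m - 1)) summable_on UNIV" "(\<Sum>\<^sub>\<infinity>m. T (m - 1)) = (\<Sum>\<^sub>\<infinity>m. T m)"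
    using T summable_on_reindex_bij_betw [OF bij, of T] infsum_reindex_bij_betw [OF bij, of T] by simp_all
  have S1: "(\<lambda>m. vwp_term q x u m) summable_on UNIV"
    using vwp_term_summable [of u 1 x] u x conv by simp
  have "norm (q * (\<Prod>k=1..4. ?x' k)) < 1"
    unfolding P' norm_mult [of q "q * _"] using q conv
    by (smt (verit) mult_left_le_one_le norm_ge_zero)
  then have S2: "(\<lambda>m. vwp_term q ?x' u m) summable_on UNIV"
    using vwp_term_summable [of u 1 ?x'] u x' by (simp del: fun_upd_apply)
  have "((\<lambda>m. (\<Prod>k\<in>{1..4}-{j}. 1 - q * (x j * x k)) * vwp_term q ?x' u m - (1 - q * (\<Prod>k=1..4. x k)) * vwp_term q x u m)
      has_sum ((\<Prod>k\<in>{1..4}-{j}. 1 - q * (x j * x k)) * vwp_sum q ?x' u - (1 - q * (\<Prod>k=1..4. x k)) * vwp_sum q x u)) UNIV"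
    unfolding vwp_sum_def by (intro has_sum_diff has_sum_cmult_right has_sum_infsum S1 S2)
  moreover have "((\<lambda>m. T m - T (m - 1)) has_sum ((\<Sum>\<^sub>\<infinity>m. T m) - (\<Sum>\<^sub>\<infinity>m. T (m - 1)))) UNIV"
    by (intro has_sum_diff has_sum_infsum T T'(1))
  moreover have "(\<lambda>m. (\<Prod>k\<in>{1..4}-{j}. 1 - q * (x j * x k)) * vwp_term q ?x' u m - (1 - q * (\<Prod>k=1..4. x k)) * vwp_term q x u m)
      = (\<lambda>m. T m - T (m - 1))"
    unfolding T_def using vwp_term_telescope [OF q u j, of x] by simp
  ultimately have "(\<Prod>k\<in>{1..4}-{j}. 1 - q * (x j * x k)) * vwp_sum q ?x' u - (1 - q * (\<Prod>k=1..4. x k)) * vwp_sum q x u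
      = (\<Sum>\<^sub>\<infinity>m. T m) - (\<Sum>\<^sub>\<infinity>m. T (m - 1))"
    by (simp only: has_sum_unique)
  then show ?thesis
    unfolding T'(2) by simp
qed

end

lemma psi_term_cong:
  assumes "\<And>j. j \<in> {1..4} \<Longrightarrow> c j = c' j" "\<And>j. j \<in> {1..4} \<Longrightarrow> d j = d' j"
  shows "psi_term q e c d u m = psi_term q e c' d' u m"
  unfolding psi_term_def
  by (intro arg_cong2 [where f = "(*)"] prod.cong refl) (simp_all only: assms)

lemma vwp_sum_cong:
  assumes "\<And>j. j \<in> {1..4} \<Longrightarrow> x j = y j"
  shows "vwp_sum q x u = vwp_sum q y u"
proof -
  have "vwp_term q x u = vwp_term q y u"
    unfolding vwp_term_def fun_eq_iff
    by (intro allI arg_cong2 [where f = "(-)"] psi_term_cong) (simp_all only: assms)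
  then show ?thesis
    by (simp only: vwp_sum_def)
qed

lemma compact_annulus_bounds:
  fixes K :: "complex set"
  assumes "compact K" "K \<subseteq> - {0}"
  obtains r R where "0 < r" "r \<le> R" "\<And>u. u \<in> K \<Longrightarrow> r \<le> norm u \<and> norm u \<le> R"
proof -
  have "open (- K)" "0 \<in> - K"
    using assms compact_imp_closed by auto
  then obtain r where r: "r > 0" "ball 0 r \<subseteq> - K"
    by (auto simp: open_contains_ball)
  obtain R where R: "\<And>u. u \<in> K \<Longrightarrow> norm u \<le> R"
    using compact_imp_bounded [OF assms(1)] by (auto simp: bounded_iff)
  show thesis
  proof (rule that [of r "max r R"])
    show "r \<le> norm u \<and> norm u \<le> max r R" if "u \<in> K" for u
      using r(2) R [OF that] that by (force simp: not_less [symmetric])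
  qed (use r in auto)
qed

section \<open>Holomorphy in u, the limit of vanishing parameters, and the summation formula\<close>

context
  fixes q :: complex
  assumes q: "0 < norm q" "norm q < 1"
begin

lemma vwp_term_holomorphic: "(\<lambda>u. vwp_term q x u m) holomorphic_on - {0}"
  unfolding vwp_term_def psi_term_def using q
  by (intro holomorphic_intros holomorphic_on_qpoch_inf [OF q]) auto

lemma vwp_sum_uniform_limit:
  assumes x: "\<And>j. j \<in> {1..4} \<Longrightarrow> x j \<noteq> 0" and conv: "norm (q * (\<Prod>j=1..4. x j)) < 1"
    and t: "norm t \<le> 1" and K: "compact K" "K \<subseteq> - {0}"
  shows "uniform_limit K (\<lambda>F u. \<Sum>m\<in>F. vwp_term q (\<lambda>j. t * x j) u m)
    (vwp_sum q (\<lambda>j. t * x j)) (finite_subsets_at_top UNIV)"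
proof -
  obtain r R where rR: "0 < r" "r \<le> R" "\<And>u. u \<in> K \<Longrightarrow> r \<le> norm u \<and> norm u \<le> R"
    using compact_annulus_bounds [OF K] by blast
  obtain M where M: "M summable_on UNIV" "\<And>m u t. r \<le> norm u \<Longrightarrow> norm u \<le> R \<Longrightarrow> norm t \<le> 1 \<Longrightarrow>
    norm (vwp_term q (\<lambda>j. t * x j) u m) \<le> M m"
  proof (rule vwp_term_bound [OF q rR(1,2) x conv])
    fix M assume *: "M summable_on UNIV" "\<And>m u t. r \<le> norm u \<Longrightarrow> norm u \<le> R \<Longrightarrow> norm t \<le> 1 \<Longrightarrow>
      norm (vwp_term q (\<lambda>j. t * x j) u m) \<le> M m"
    show thesis by (rule that [OF *])
  qed
  show ?thesis
    unfolding vwp_sum_def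
    by (rule Weierstrass_m_test_general [OF _ M(1)]) (use M(2) rR(3) t in blast)
qed

lemma vwp_sum_holomorphic:
  assumes x: "\<And>j. j \<in> {1..4} \<Longrightarrow> x j \<noteq> 0" and conv: "norm (q * (\<Prod>j=1..4. x j)) < 1"
    and t: "norm t \<le> 1"
  shows "vwp_sum q (\<lambda>j. t * x j) holomorphic_on - {0}"
proof -
  have "vwp_sum q (\<lambda>j. t * x j) field_differentiable (at z)" if "z \<in> - {0}" for z
  proof -
    have "open (- {0::complex})" by auto
    with that obtain r where r: "r > 0" "cball z r \<subseteq> - {0}"
      by (meson open_contains_cball)
    have hol: "(\<lambda>u. \<Sum>m\<in>F. vwp_term q (\<lambda>j. t * x j) u m) holomorphic_on - {0}" for F
      by (intro holomorphic_on_sum vwp_term_holomorphic)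
    have ul: "uniform_limit (cball z r) (\<lambda>F u. \<Sum>m\<in>F. vwp_term q (\<lambda>j. t * x j) u m)
      (vwp_sum q (\<lambda>j. t * x j)) (finite_subsets_at_top UNIV)"
      by (rule vwp_sum_uniform_limit [OF x conv t compact_cball r(2)])
    have "vwp_sum q (\<lambda>j. t * x j) holomorphic_on ball z r"
    proof (rule holomorphic_uniform_limit [OF _ ul])
      show "\<forall>\<^sub>F F in finite_subsets_at_top UNIV. continuous_on (cball z r) (\<lambda>u. \<Sum>m\<in>F. vwp_term q (\<lambda>j. t * x j) u m)
         \<and> (\<lambda>u. \<Sum>m\<in>F. vwp_term q (\<lambda>j. t * x j) u m) holomorphic_on ball z r"
        using r(2) ball_subset_cball [of z r]
        by (intro always_eventually allI conjI holomorphic_on_imp_continuous_on holomorphic_on_subset [OF hol]) auto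
    qed auto
    then show ?thesis
      using r(1) holomorphic_on_imp_differentiable_at [OF _ open_ball, of "vwp_sum q (\<lambda>j. t * x j)" z r z] by simp
  qed
  then show ?thesis
    unfolding holomorphic_on_def by (blast intro: field_differentiable_at_within)
qed

text \<open>The majorant is uniform for |t| <= 1, so the series is continuous in the scaling
  variable t on the closed disc; the limit is the value at t = 0, approached along t = q^N.\<close>

lemma vwp_sum_tendsto:
  assumes u: "u \<noteq> 0" and x: "\<And>j. j \<in> {1..4} \<Longrightarrow> x j \<noteq> 0" and conv: "norm (q * (\<Prod>j=1..4. x j)) < 1"
  shows "(\<lambda>N. vwp_sum q (\<lambda>j. q ^ N * x j) u) \<longlonglongrightarrow> vwp_sum q (\<lambda>j. 0) u"
proof -
  have u0: "0 < norm u" using u by simp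
  obtain M where M: "M summable_on UNIV" "\<And>m v t. norm u \<le> norm v \<Longrightarrow> norm v \<le> norm u \<Longrightarrow> norm t \<le> 1 \<Longrightarrow>
    norm (vwp_term q (\<lambda>j. t * x j) v m) \<le> M m"
  proof (rule vwp_term_bound [OF q u0 order_refl x conv])
    fix M assume *: "M summable_on UNIV" "\<And>m v t. norm u \<le> norm v \<Longrightarrow> norm v \<le> norm u \<Longrightarrow> norm t \<le> 1 \<Longrightarrow>
      norm (vwp_term q (\<lambda>j. t * x j) v m) \<le> M m"
    show thesis by (rule that [OF *])
  qed
  have ul: "uniform_limit (cball 0 1) (\<lambda>F t. \<Sum>m\<in>F. vwp_term q (\<lambda>j. t * x j) u m)
      (\<lambda>t. vwp_sum q (\<lambda>j. t * x j) u) (finite_subsets_at_top UNIV)"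
    unfolding vwp_sum_def
    by (rule Weierstrass_m_test_general [OF _ M(1)]) (use M(2) [OF order_refl order_refl] in simp)
  have "continuous_on (cball 0 1) (\<lambda>t. vwp_sum q (\<lambda>j. t * x j) u)"
  proof (rule uniform_limit_theorem [OF _ ul])
    show "\<forall>\<^sub>F F in finite_subsets_at_top UNIV. continuous_on (cball 0 1) (\<lambda>t. \<Sum>m\<in>F. vwp_term q (\<lambda>j. t * x j) u m)"
    proof (intro always_eventually allI continuous_on_sum holomorphic_on_imp_continuous_on)
      show "(\<lambda>t. vwp_term q (\<lambda>j. t * x j) u m) holomorphic_on cball 0 1" for m
        unfolding vwp_term_def psi_term_def
        by (intro holomorphic_on_const holomorphic_on_ident holomorphic_on_diff holomorphic_on_mult holomorphic_on_prod
            holomorphic_on_divide holomorphic_on_qpoch_inf [OF q] u)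
    qed
  qed auto
  moreover have "(\<lambda>N. q ^ N) \<longlonglongrightarrow> 0"
    using q by (intro LIMSEQ_power_zero)
  moreover have "\<forall>\<^sub>F N in sequentially. q ^ N \<in> cball 0 1"
    using q by (auto simp: norm_power power_le_one)
  ultimately have "(\<lambda>N. vwp_sum q (\<lambda>j. q ^ N * x j) u) \<longlonglongrightarrow> vwp_sum q (\<lambda>j. 0 * x j) u"
    by (intro continuous_on_tendsto_compose [where f = "\<lambda>t. vwp_sum q (\<lambda>j. t * x j) u"]) auto
  then show ?thesis by simp
qed

text \<open>Under x_j -> q x_j the factorial on the left releases 1 - q x_1 x_2 x_3 x_4, which the
  recurrence of the series converts into the product of 1 - q x_j x_k over k different from j. The
  six factorials on the right release exactly this product. In the limit all factorials tend to 1
  and the series at x = 0 remains. This is Bailey's summation, cross-multiplied and with its theta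
  factor left as a series.\<close>

theorem very_well_poised_6psi6:
  assumes u: "u \<noteq> 0" and x: "\<And>j. j \<in> {1..4} \<Longrightarrow> x j \<noteq> 0" and conv: "norm (q * (\<Prod>j=1..4. x j)) < 1"
  shows "qpoch_inf (q * (\<Prod>j=1..4. x j)) q * vwp_sum q x u =
    (\<Prod>i=1..4. \<Prod>k=i+1..4. qpoch_inf (q * (x i * x k)) q) * vwp_sum q (\<lambda>j. 0) u"
proof -
  define X where "X = (\<lambda>y. qpoch_inf (q * (\<Prod>j=1..4. y j)) q * vwp_sum q y u)"
  define Y where "Y = (\<lambda>y :: nat \<Rightarrow> complex. \<Prod>i=1..4. \<Prod>k=i+1..4. qpoch_inf (q * (y i * y k)) q)"
  define Q where "Q = (\<lambda>y :: nat \<Rightarrow> complex. (\<forall>j\<in>{1..4}. y j \<noteq> 0) \<and> norm (q * (\<Prod>j=1..4. y j)) < 1)"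
  have q0: "q \<noteq> 0" using q by auto
  have "X x * 1 = Y x * (1 * vwp_sum q (\<lambda>j. 0) u)"
  proof (rule scaling_recurrence [where q = q and Q = Q and X = X and Y = Y and y = x])
    show "Q x" using x conv by (simp add: Q_def)
    show "X y = X z \<and> Y y = Y z" if "\<And>j. j \<in> {1..4} \<Longrightarrow> y j = z j" for y z
    proof
      have "(\<Prod>j=1..4. y j) = (\<Prod>j=1..4. z j)"
        by (rule prod.cong [OF refl that])
      then show "X y = X z"
        using vwp_sum_cong [of y z q u, OF that] by (simp only: X_def)
      show "Y y = Y z"
        unfolding Y_def by (intro prod.cong refl) (simp add: that)
    qed
    have lim: "(\<lambda>N. qpoch_inf (q * f N) q) \<longlonglongrightarrow> 1" if "f \<longlonglongrightarrow> 0" for f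
      using tendsto_qpoch_inf [OF q tendsto_mult [OF tendsto_const [of q] that]] q
      by (simp add: qpoch_inf_0 [OF q])
    have qN: "(\<lambda>N. q ^ N) \<longlonglongrightarrow> 0"
      using q by (intro LIMSEQ_power_zero)
    have "(\<lambda>N. \<Prod>j=1..4. q ^ N * x j) \<longlonglongrightarrow> (\<Prod>j=(1::nat)..4. 0 * x j)"
      by (intro tendsto_intros qN)
    then show "(\<lambda>N. X (\<lambda>j. q ^ N * x j)) \<longlonglongrightarrow> 1 * vwp_sum q (\<lambda>j. 0) u"
      unfolding X_def by (intro tendsto_mult lim vwp_sum_tendsto u x conv) auto
    have "(\<lambda>N. Y (\<lambda>j. q ^ N * x j)) \<longlonglongrightarrow> (\<Prod>i=(1::nat)..4. \<Prod>k=i+1..4. 1)"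
      unfolding Y_def
    proof (intro tendsto_prod lim)
      fix i k
      have "(\<lambda>N. q ^ N * x i * (q ^ N * x k)) \<longlonglongrightarrow> 0 * x i * (0 * x k)"
        by (intro tendsto_intros qN)
      then show "(\<lambda>N. q ^ N * x i * (q ^ N * x k)) \<longlonglongrightarrow> 0" by simp
    qed
    then show "(\<lambda>N. Y (\<lambda>j. q ^ N * x j)) \<longlonglongrightarrow> 1" by simp
    fix y j assume y: "Q y" and j: "j \<in> {1..4::nat}"
    let ?y' = "y(j := q * y j)"
    have P': "(\<Prod>k=1..4. ?y' k) = q * (\<Prod>k=1..4. y k)"
      using j by (simp add: prod.remove [of _ j])
    have "norm (q * (q * (\<Prod>k=1..4. y k))) < 1"
      unfolding norm_mult [of q "q * _"] using q y unfolding Q_def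
      by (smt (verit) mult_left_le_one_le norm_ge_zero)
    then have Q': "Q ?y'" unfolding Q_def P' using y q0 by (auto simp: Q_def)
    define r where "r = (\<Prod>k\<in>{1..4}-{j}. 1 - q * (y j * y k))"
    have S: "(1 - q * (\<Prod>k=1..4. y k)) * vwp_sum q y u = r * vwp_sum q ?y' u"
      unfolding r_def using y by (intro vwp_sum_recurrence [OF q u _ _ j]) (auto simp: Q_def)
    have "qpoch_inf (q * (\<Prod>k=1..4. y k)) q = (1 - q * (\<Prod>k=1..4. y k)) * qpoch_inf (q * (\<Prod>k=1..4. ?y' k)) q"
      unfolding P' by (rule qpoch_inf_rec [OF q])
    then have "X y = qpoch_inf (q * (\<Prod>k=1..4. ?y' k)) q * ((1 - q * (\<Prod>k=1..4. y k)) * vwp_sum q y u)"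
      unfolding X_def by (simp only: mult_ac)
    then have X: "X y = r * X ?y'"
      unfolding X_def S by (simp only: mult_ac)
    obtain k1 k2 k3 where k: "{1..4} - {j} = {k1, k2, k3}" "distinct [j, k1, k2, k3]"
      and p: "\<And>g :: nat \<Rightarrow> nat \<Rightarrow> complex. (\<And>i k. g i k = g k i) \<Longrightarrow>
       (\<Prod>i=1..4. \<Prod>k=i+1..4. g i k) = g j k1 * g j k2 * g j k3 * (g k1 k2 * g k1 k3 * g k2 k3)"
    proof (rule prod_1_4_split [OF j])
      fix k1 k2 k3
      assume *: "{1..4} - {j} = {k1, k2, k3}" "distinct [j, k1, k2, k3]"
        "\<And>g :: nat \<Rightarrow> nat \<Rightarrow> complex. (\<And>i k. g i k = g k i) \<Longrightarrow>
       (\<Prod>i=1..4. \<Prod>k=i+1..4. g i k) = g j k1 * g j k2 * g j k3 * (g k1 k2 * g k1 k3 * g k2 k3)"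
      show thesis by (rule that [OF *])
    qed
    let ?P = "\<lambda>z i k. qpoch_inf (q * (z i * z k)) q"
    have Yz: "Y z = ?P z j k1 * ?P z j k2 * ?P z j k3 * (?P z k1 k2 * ?P z k1 k3 * ?P z k2 k3)" for z
      unfolding Y_def by (rule p) (simp only: mult.commute)
    have rr: "r = (1 - q * (y j * y k1)) * (1 - q * (y j * y k2)) * (1 - q * (y j * y k3))"
      unfolding r_def k(1) using k(2) by (simp add: mult_ac)
    have y': "?y' j = q * y j" "?y' k1 = y k1" "?y' k2 = y k2" "?y' k3 = y k3" using k(2) by auto
    have a: "q * y j * y k = q * (y j * y k)" for k by simp
    have Y: "Y y = r * Y ?y'"
      unfolding Yz rr y'
        qpoch_inf_rec [OF q, of "q * (y j * y k1)"] qpoch_inf_rec [OF q, of "q * (y j * y k2)"]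
        qpoch_inf_rec [OF q, of "q * (y j * y k3)"] a
      by (simp only: mult_ac)
    show "Q ?y' \<and> (\<exists>r. X y = r * X ?y' \<and> Y y = r * Y ?y')"
      using Q' X Y by blast
  qed
  then show ?thesis by (simp add: X_def Y_def)
qed

end

section \<open>Deformation of contours\<close>

text \<open>The curves may have different base points. A path p in S joins them, and the loop g, p,
  reversed h, reversed p has winding number 0 about every point outside S, since the two
  contributions of p cancel; the homology form of Cauchy's theorem applies to it. Connectedness of S
  provides p.\<close>

lemma contour_integral_eq_homologous:
  assumes S: "open S" "connected S" "f holomorphic_on S"
    and g: "valid_path g" "pathfinish g = pathstart g" "path_image g \<subseteq> S"
    and h: "valid_path h" "pathfinish h = pathstart h" "path_image h \<subseteq> S"
    and wn: "\<And>z. z \<notin> S \<Longrightarrow> winding_number g z = winding_number h z"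
  shows "contour_integral g f = contour_integral h f"
proof -
  have "pathstart g \<in> S" "pathstart h \<in> S"
    using g(3) h(3) by auto
  then obtain p where p: "polynomial_function p" "path_image p \<subseteq> S"
      "pathstart p = pathstart g" "pathfinish p = pathstart h"
    using connected_open_polynomial_connected [OF S(1,2)] by metis
  have vp: "valid_path p" using p by (simp add: valid_path_polynomial_function)
  note vs = g(1) h(1) vp and ps = valid_path_imp_path [OF g(1)] valid_path_imp_path [OF h(1)] valid_path_imp_path [OF vp]
  let ?\<gamma> = "g +++ (p +++ (reversepath h +++ reversepath p))"
  have int: "f contour_integrable_on g" "f contour_integrable_on h" "f contour_integrable_on p"
    using S g h p vp by (auto intro: contour_integrable_holomorphic_simple)
  have "(f has_contour_integral 0) ?\<gamma>"
  proof (rule Cauchy_theorem_global [OF S(1) S(3)])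
    show "valid_path ?\<gamma>" using vs p g h by (auto intro!: valid_path_join)
    show "path_image ?\<gamma> \<subseteq> S"
      using g h p by (auto simp: path_image_join)
    fix z assume z: "z \<notin> S"
    then have n: "z \<notin> path_image g" "z \<notin> path_image h" "z \<notin> path_image p" using g h p by auto
    show "winding_number ?\<gamma> z = 0"
      using n ps p g h wn [OF z]
      by (simp add: winding_number_join winding_number_reversepath path_image_join not_in_path_image_join)
  qed (use p g h in auto)
  then have "contour_integral ?\<gamma> f = 0" by (rule contour_integral_unique)
  moreover have "contour_integral ?\<gamma> f = contour_integral g f - contour_integral h f"
    using int vs p g h
    by (simp add: valid_path_join contour_integrable_reversepath contour_integrable_joinI
        contour_integral_reversepath)
  ultimately show ?thesis by simp
qed

section \<open>Contour integrals under scaling and under limits\<close>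

lemma valid_path_scale: "valid_path \<gamma> \<Longrightarrow> valid_path ((*) c \<circ> \<gamma>)" for c :: complex
  by (rule valid_path_compose_holomorphic [where S = UNIV]) (auto intro!: holomorphic_intros)

lemma contour_integral_scale:
  assumes "valid_path \<gamma>"
  shows "contour_integral ((*) c \<circ> \<gamma>) f = contour_integral \<gamma> (\<lambda>z. c * f (c * z))"
proof -
  have "deriv ((*) c) z = c" for z :: complex
    by (rule DERIV_imp_deriv) (auto intro!: derivative_eq_intros)
  then show ?thesis
    using contour_integral_comp_analyticW [of "(*) c" UNIV \<gamma> f] assms
    by (auto intro!: analytic_intros)
qed

lemma winding_number_scale:
  assumes "valid_path \<gamma>" "z \<notin> path_image \<gamma>" "c \<noteq> 0"
  shows "winding_number ((*) c \<circ> \<gamma>) (c * z) = winding_number \<gamma> z"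
proof -
  have "c * z \<notin> path_image ((*) c \<circ> \<gamma>)"
    using assms by (auto simp: path_image_compose)
  then have "winding_number ((*) c \<circ> \<gamma>) (c * z) =
      1 / (2 * pi * \<i>) * contour_integral \<gamma> (\<lambda>w. c * (1 / (c * w - c * z)))"
    using assms by (simp add: winding_number_valid_path valid_path_scale contour_integral_scale)
  also have "(\<lambda>w. c * (1 / (c * w - c * z))) = (\<lambda>w. 1 / (w - z))"
    using assms by (simp add: fun_eq_iff flip: right_diff_distrib)
  finally show ?thesis
    using assms by (simp add: winding_number_valid_path o_def)
qed

text \<open>The bound of an integral by a multiple of the supremum is available for functions
  holomorphic on an open neighbourhood of the path. Hence the open set \<open>S'\<close> around the
  path, enclosed in a compact \<open>K\<close> inside S on which convergence is uniform.\<close>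

lemma contour_integral_tendsto:
  assumes S: "open S" and \<gamma>: "valid_path \<gamma>" "path_image \<gamma> \<subseteq> S"
    and f: "\<forall>\<^sub>F n in F. f n holomorphic_on S" and g: "g holomorphic_on S"
    and lim: "\<And>K. compact K \<Longrightarrow> K \<subseteq> S \<Longrightarrow> uniform_limit K f g F"
  shows "((\<lambda>n. contour_integral \<gamma> (f n)) \<longlongrightarrow> contour_integral \<gamma> g) F"
proof -
  have cp: "compact (path_image \<gamma>)" using \<gamma> by (simp add: compact_valid_path_image)
  obtain e :: real where e: "e > 0" "{x + y | x y. x \<in> path_image \<gamma> \<and> y \<in> cball 0 e} \<subseteq> S"
  proof -
    obtain e :: real where e: "e > 0" "(\<Union>x\<in>path_image \<gamma>. cball x e) \<subseteq> S"
      using compact_subset_open_imp_cball_epsilon_subset [OF cp S \<gamma>(2)] by metis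
    have "x + y \<in> cball x e" if "y \<in> cball 0 e" for x y :: complex
      using that by (simp add: dist_norm)
    then have "{x + y | x y. x \<in> path_image \<gamma> \<and> y \<in> cball 0 e} \<subseteq> (\<Union>x\<in>path_image \<gamma>. cball x e)"
      by fast
    from subset_trans [OF this e(2)] show thesis by (rule that [OF e(1)])
  qed
  define K where "K = {x + y | x y. x \<in> path_image \<gamma> \<and> y \<in> cball 0 e}"
  have K: "compact K" unfolding K_def by (rule compact_sums [OF cp compact_cball])
  define S' where "S' = (\<Union>x\<in>path_image \<gamma>. ball x e)"
  have S': "open S'" "path_image \<gamma> \<subseteq> S'"
    using e(1) by (auto simp: S'_def)
  have S'K: "S' \<subseteq> K"
  proof
    fix z assume "z \<in> S'"
    then obtain x where "x \<in> path_image \<gamma>" "z \<in> ball x e" by (auto simp: S'_def)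
    then have "z = x + (z - x)" "z - x \<in> cball 0 e"
      by (auto simp: dist_norm norm_minus_commute)
    with \<open>x \<in> path_image \<gamma>\<close> show "z \<in> K" unfolding K_def by blast
  qed
  have KS: "K \<subseteq> S" using e(2) by (simp only: K_def)
  obtain L where "0 < L \<and> (\<forall>f B. f holomorphic_on S' \<and> (\<forall>z\<in>S'. norm (f z) \<le> B)
      \<longrightarrow> norm (contour_integral \<gamma> f) \<le> L * B)"
    using contour_integral_bound_exists [OF S'(1) \<gamma>(1) S'(2)] by (elim exE)
  then have L: "0 < L" "\<And>f B. f holomorphic_on S' \<Longrightarrow> \<forall>z\<in>S'. norm (f z) \<le> B \<Longrightarrow>
      norm (contour_integral \<gamma> f) \<le> L * B"
    by simp_all
  show ?thesis
  proof (rule tendstoI)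
    fix d :: real assume d: "d > 0"
    have "\<forall>\<^sub>F n in F. \<forall>z\<in>K. dist (f n z) (g z) < d / (2 * L)"
      using lim [OF K KS] d L by (intro uniform_limitD) auto
    with f show "\<forall>\<^sub>F n in F. dist (contour_integral \<gamma> (f n)) (contour_integral \<gamma> g) < d"
    proof eventually_elim
      case (elim n)
      have "f n contour_integrable_on \<gamma>" "g contour_integrable_on \<gamma>"
        using elim(1) g S \<gamma> by (auto intro: contour_integrable_holomorphic_simple)
      then have "dist (contour_integral \<gamma> (f n)) (contour_integral \<gamma> g) =
          norm (contour_integral \<gamma> (\<lambda>z. f n z - g z))"
        by (simp add: contour_integral_diff dist_norm)
      also have "\<dots> \<le> L * (d / (2 * L))"
      proof (rule L(2))
        show "(\<lambda>z. f n z - g z) holomorphic_on S'"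
          using elim(1) g subset_trans [OF S'K KS] by (intro holomorphic_on_diff) (rule holomorphic_on_subset; simp)+
        show "\<forall>z\<in>S'. norm (f n z - g z) \<le> d / (2 * L)"
          using elim(2) S'K by (auto simp: dist_norm intro!: less_imp_le)
      qed
      also have "\<dots> < d" using d L by simp
      finally show ?case .
    qed
  qed
qed

text \<open>All powers other than 1/z have a primitive on the punctured plane. The shift k - 1 makes
  k the exponent of a monomial integrated against dz/z.\<close>

lemma contour_integral_powi:
  assumes \<gamma>: "valid_path \<gamma>" "pathfinish \<gamma> = pathstart \<gamma>" "0 \<notin> path_image \<gamma>"
  shows "contour_integral \<gamma> (\<lambda>z. z powi (k - 1)) = (if k = 0 then 2 * pi * \<i> * winding_number \<gamma> 0 else 0)"
proof (cases "k = 0")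
  case True
  have "(\<lambda>z. z powi (0 - 1)) = (\<lambda>w. 1 / (w - 0 :: complex))"
    by (auto simp: fun_eq_iff inverse_eq_divide)
  then show ?thesis
    unfolding True using winding_number_valid_path [OF \<gamma>(1,3)] by simp
next
  case False
  have "((\<lambda>z. z powi (k - 1)) has_contour_integral 0) \<gamma>"
  proof (rule Cauchy_theorem_primitive [where S = "-{0}"])
    fix z :: complex assume "z \<in> -{0}"
    then have "((\<lambda>z. z powi k / of_int k) has_field_derivative (of_int k * z powi (k - 1) * 1) / of_int k) (at z within -{0})"
      by (intro DERIV_cdivide DERIV_power_int DERIV_ident) auto
    then show "((\<lambda>z. z powi k / of_int k) has_field_derivative z powi (k - 1)) (at z within -{0})"
      using False by simp
  qed (use assms in auto)
  then show ?thesis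
    using False by (simp add: contour_integral_unique)
qed

section \<open>The Askey--Wilson integral\<close>

lemma separating_contour_0:
  assumes "separating_contour q s b 0 \<gamma>"
  shows "valid_path \<gamma>" "pathfinish \<gamma> = pathstart \<gamma>" "0 \<notin> path_image \<gamma>" "winding_number \<gamma> 0 = 1"
    and "j \<in> {1..4} \<Longrightarrow> b j * q ^ k \<notin> path_image \<gamma> \<and> winding_number \<gamma> (b j * q ^ k) = 1"
    and "j \<in> {1..4} \<Longrightarrow> 1 / (b j * q ^ k) \<notin> path_image \<gamma> \<and> winding_number \<gamma> (1 / (b j * q ^ k)) = 0"
proof -
  note s = assms [unfolded separating_contour_def]
  show "valid_path \<gamma>" "pathfinish \<gamma> = pathstart \<gamma>" "0 \<notin> path_image \<gamma>" "winding_number \<gamma> 0 = 1"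
    using s by blast+
  assume j: "j \<in> {1..4}"
  have "s powi (- 0) * q ^ k * b j \<in> poles_to_zero q s b 0"
    unfolding poles_to_zero_def using j by blast
  then have 1: "b j * q ^ k \<in> poles_to_zero q s b 0"
    by (simp add: mult.commute)
  then show "b j * q ^ k \<notin> path_image \<gamma> \<and> winding_number \<gamma> (b j * q ^ k) = 1"
    using s by blast
  have "s powi (- 0) / (q ^ k * b j) \<in> poles_to_infinity q s b 0"
    unfolding poles_to_infinity_def using j by blast
  then have 1: "1 / (b j * q ^ k) \<in> poles_to_infinity q s b 0"
    by (simp add: mult.commute)
  then show "1 / (b j * q ^ k) \<notin> path_image \<gamma> \<and> winding_number \<gamma> (1 / (b j * q ^ k)) = 0"
    using s by blast
qed

text \<open>Replacing b_j by q b_j deletes the first point of each of the two pole sequences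
  belonging to j and creates none. One contour can therefore be kept throughout the descent.\<close>

lemma separating_contour_0_scale:
  assumes "separating_contour q s b 0 \<gamma>" and j: "j \<in> {1..4}"
  shows "separating_contour q s (b(j := q * b j)) 0 \<gamma>"
proof -
  have "poles_to_zero q s (b(j := q * b j)) 0 \<subseteq> poles_to_zero q s b 0"
  proof
    fix p assume "p \<in> poles_to_zero q s (b(j := q * b j)) 0"
    then obtain i k where i: "i \<in> {1..4}" "p = q ^ k * (b(j := q * b j)) i"
      by (auto simp: poles_to_zero_def)
    then have "p = s powi (- 0) * q ^ (if i = j then Suc k else k) * b i"
      by simp
    with i(1) show "p \<in> poles_to_zero q s b 0"
      unfolding poles_to_zero_def by blast
  qed
  moreover have "poles_to_infinity q s (b(j := q * b j)) 0 \<subseteq> poles_to_infinity q s b 0"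
  proof
    fix p assume "p \<in> poles_to_infinity q s (b(j := q * b j)) 0"
    then obtain i k where i: "i \<in> {1..4}" "p = 1 / (q ^ k * (b(j := q * b j)) i)"
      by (auto simp: poles_to_infinity_def)
    then have "p = s powi (- 0) / (q ^ (if i = j then Suc k else k) * b i)"
      by simp
    with i(1) show "p \<in> poles_to_infinity q s b 0"
      unfolding poles_to_infinity_def by blast
  qed
  ultimately show ?thesis
    using assms(1) unfolding separating_contour_def by blast
qed

text \<open>Two families are kept apart because the auxiliary function of the contour shift has q b
  in one and b in the other.\<close>

definition aw_denom :: "complex \<Rightarrow> (nat \<Rightarrow> complex) \<Rightarrow> (nat \<Rightarrow> complex) \<Rightarrow> complex \<Rightarrow> complex" where
  "aw_denom q c d u = (\<Prod>j=1..4. qpoch_inf (c j * u) q * qpoch_inf (d j / u) q)"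

definition aw_domain :: "complex \<Rightarrow> (nat \<Rightarrow> complex) \<Rightarrow> (nat \<Rightarrow> complex) \<Rightarrow> complex set" where
  "aw_domain q c d = {u. u \<noteq> 0 \<and> aw_denom q c d u \<noteq> 0}"

text \<open>The 1/u of the measure is included, 1/(2 pi i) is not; the constant term 2 will thus
  appear as 4 pi i.\<close>

definition aw_integrand :: "complex \<Rightarrow> (nat \<Rightarrow> complex) \<Rightarrow> complex \<Rightarrow> complex" where
  "aw_integrand q b u = (1 - u^2) * vwp_sum q (\<lambda>j. 0) u / (u * aw_denom q b b u)"

section \<open>The contour shift and the limit of vanishing b\<close>

context
  fixes q :: complex
  assumes q: "0 < norm q" "norm q < 1"
begin

lemma vwp_sum_q_shift:
  assumes "u \<noteq> 0"
  shows "vwp_sum q x (q * u) = 1 / (q^3 * u^4) * vwp_sum q x u"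
proof -
  have "vwp_term q x (q * u) m = 1 / (q^3 * u^4) * vwp_term q x u (m - 1)" for m
    unfolding vwp_term_def psi_term_q_shift [OF q assms] by (simp only: right_diff_distrib)
  then have "vwp_sum q x (q * u) = (\<Sum>\<^sub>\<infinity>m. 1 / (q^3 * u^4) * vwp_term q x u (m - 1))"
    by (simp only: vwp_sum_def)
  also have "\<dots> = 1 / (q^3 * u^4) * (\<Sum>\<^sub>\<infinity>m. vwp_term q x u (m - 1))"
    by (rule infsum_cmult_right')
  also have "bij_betw (\<lambda>m::int. m - 1) UNIV UNIV"
    by (rule bij_betwI [of _ _ _ "\<lambda>m. m + 1"]) auto
  then have "(\<Sum>\<^sub>\<infinity>m. vwp_term q x u (m - 1)) = vwp_sum q x u"
    unfolding vwp_sum_def by (rule infsum_reindex_bij_betw)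
  finally show ?thesis .
qed

lemma aw_domain_iff:
  "u \<in> aw_domain q c d \<longleftrightarrow> u \<noteq> 0 \<and> (\<forall>j\<in>{1..4}. \<forall>k. u \<noteq> 1 / (c j * q ^ k) \<and> u \<noteq> d j * q ^ k)"
proof (cases "u = 0")
  case False
  have q0: "q \<noteq> 0" using q by auto
  \<comment> \<open>For c_j = 0 the quotient on the right is 0 by convention, and both sides are
    false since u is nonzero.\<close>
  have 1: "c j * u * q ^ k = 1 \<longleftrightarrow> u = 1 / (c j * q ^ k)" for j k
    using False q0 by (cases "c j = 0") (auto simp: field_simps)
  have 2: "d j / u * q ^ k = 1 \<longleftrightarrow> u = d j * q ^ k" for j k
    using False by (auto simp: field_simps)
  show ?thesis
    using False by (auto simp: aw_domain_def aw_denom_def qpoch_inf_eq_0_iff [OF q] 1 2)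
qed (simp add: aw_domain_def)

lemma aw_denom_holomorphic: "aw_denom q c d holomorphic_on - {0}"
  unfolding aw_denom_def
  by (intro holomorphic_on_prod holomorphic_on_mult holomorphic_on_qpoch_inf [OF q] holomorphic_on_divide
      holomorphic_on_const holomorphic_on_ident) auto

lemma open_aw_domain: "open (aw_domain q c d)"
proof -
  have "open (- {0} \<inter> aw_denom q c d -` (- {0}))"
    by (intro continuous_open_preimage holomorphic_on_imp_continuous_on aw_denom_holomorphic) auto
  moreover have "- {0} \<inter> aw_denom q c d -` (- {0}) = aw_domain q c d"
    by (auto simp: aw_domain_def)
  ultimately show ?thesis by simp
qed

text \<open>The complement consists of 0 and countably many poles, and removing a countable set does
  not disconnect the plane.\<close>

lemma connected_aw_domain: "connected (aw_domain q c d)"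
proof -
  let ?T = "{0} \<union> (\<Union>j\<in>{1..4}. (range (\<lambda>k. 1 / (c j * q ^ k)) \<union> range (\<lambda>k. d j * q ^ k)))"
  have "u \<in> ?T \<longleftrightarrow> u = 0 \<or> (\<exists>j\<in>{1..4}. \<exists>k. u = 1 / (c j * q ^ k) \<or> u = d j * q ^ k)" for u
    by blast
  then have "aw_domain q c d = UNIV - ?T"
    unfolding set_eq_iff Diff_iff aw_domain_iff by blast
  moreover have "connected (UNIV - ?T)"
    by (rule connected_open_diff_countable) auto
  ultimately show ?thesis by simp
qed

lemma theta_holomorphic: "vwp_sum q (\<lambda>j. 0) holomorphic_on - {0}"
  \<comment> \<open>Zero parameters are reached as t x with x = 1 and t = 0, since the general
    statement asks for nonzero x.\<close>
  using vwp_sum_holomorphic [OF q, of "\<lambda>_. 1" 0] q by simp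

lemma aw_integrand_holomorphic: "aw_integrand q b holomorphic_on aw_domain q b b"
proof -
  have "aw_domain q b b \<subseteq> - {0}" by (auto simp: aw_domain_def)
  then show ?thesis
    unfolding aw_integrand_def
    by (intro holomorphic_on_divide holomorphic_on_mult holomorphic_on_diff holomorphic_on_power
        holomorphic_on_const holomorphic_on_ident holomorphic_on_subset [OF theta_holomorphic]
        holomorphic_on_subset [OF aw_denom_holomorphic]) (auto simp: aw_domain_def)
qed

lemma path_image_aw_domain:
  assumes "separating_contour q s b 0 \<gamma>"
  shows "path_image \<gamma> \<subseteq> aw_domain q b b"
proof
  fix u assume u: "u \<in> path_image \<gamma>"
  note sep = separating_contour_0 [OF assms]
  show "u \<in> aw_domain q b b"
    unfolding aw_domain_iff
  proof (intro conjI ballI allI)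
    show "u \<noteq> 0" using u sep(3) by auto
    fix j k assume j: "j \<in> {1..4::nat}"
    show "u \<noteq> 1 / (b j * q ^ k)" using u sep(6) [OF j, of k] by auto
    show "u \<noteq> b j * q ^ k" using u sep(5) [OF j, of k] by auto
  qed
qed

lemma path_image_aw_domain_shift:
  assumes "separating_contour q s b 0 \<gamma>"
  shows "path_image \<gamma> \<subseteq> aw_domain q (\<lambda>j. q * b j) b"
    "path_image ((*) (1/q) \<circ> \<gamma>) \<subseteq> aw_domain q (\<lambda>j. q * b j) b"
proof -
  have q0: "q \<noteq> 0" using q by auto
  note sep = separating_contour_0 [OF assms]
  have s6: "u \<noteq> 1 / (b j * q ^ k)" "u \<noteq> b j * q ^ k" if "u \<in> path_image \<gamma>" "j \<in> {1..4}" for u j k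
    using sep(5) [OF that(2), of k] sep(6) [OF that(2), of k] that(1) by auto
  have s6': "1 / (q * b j * q ^ k) = 1 / (b j * q ^ Suc k)" for j k
    by (simp add: mult_ac)
  show "path_image \<gamma> \<subseteq> aw_domain q (\<lambda>j. q * b j) b"
  proof
    fix u assume u: "u \<in> path_image \<gamma>"
    show "u \<in> aw_domain q (\<lambda>j. q * b j) b"
      unfolding aw_domain_iff s6' using u s6 sep(3) by metis
  qed
  show "path_image ((*) (1/q) \<circ> \<gamma>) \<subseteq> aw_domain q (\<lambda>j. q * b j) b"
  proof
    fix z assume "z \<in> path_image ((*) (1/q) \<circ> \<gamma>)"
    then obtain u where u: "u \<in> path_image \<gamma>" "z = u / q"
      by (auto simp: path_image_compose)
    have "u / q \<noteq> 1 / (q * b j * q ^ k)" if "j \<in> {1..4}" for j k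
      using s6(1) [OF u(1) that, of k] q0 by (simp add: field_simps)
    moreover have "u / q \<noteq> b j * q ^ k" if "j \<in> {1..4}" for j k
      using s6(2) [OF u(1) that, of "Suc k"] q0 by (simp add: field_simps)
    moreover have "u \<noteq> 0" using u sep(3) by metis
    ultimately show "z \<in> aw_domain q (\<lambda>j. q * b j) b"
      unfolding aw_domain_iff u(2) using q0 by simp
  qed
qed

text \<open>With q b in the first family the outer poles begin one step later, at 1/(q b_j). The
  points 1/(b_j q^(k+1)) and b_j q^k lie relative to the contour divided by q as 1/(b_j q^k) and b_j
  q^(k+1) lie relative to the original one. Hence dividing the contour by q crosses no pole.\<close>

lemma aw_shift_invariance:
  assumes sep: "separating_contour q s b 0 \<gamma>" and f: "f holomorphic_on aw_domain q (\<lambda>j. q * b j) b"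
  shows "contour_integral \<gamma> f = contour_integral \<gamma> (\<lambda>z. 1 / q * f (z / q))"
proof -
  have q0: "q \<noteq> 0" using q by auto
  note s = separating_contour_0 [OF sep]
  have s6': "1 / (q * b j * q ^ k) = 1 / (b j * q ^ Suc k)" for j k
    by (simp add: mult_ac)
  have "contour_integral ((*) (1/q) \<circ> \<gamma>) f = contour_integral \<gamma> f"
  proof (rule contour_integral_eq_homologous [OF open_aw_domain connected_aw_domain f])
    show "valid_path ((*) (1/q) \<circ> \<gamma>)" by (rule valid_path_scale [OF s(1)])
    show "pathfinish ((*) (1/q) \<circ> \<gamma>) = pathstart ((*) (1/q) \<circ> \<gamma>)"
      using s(2) by (simp add: pathfinish_compose pathstart_compose)
    fix z assume "z \<notin> aw_domain q (\<lambda>j. q * b j) b"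
    then consider "z = 0" | j k where "j \<in> {1..4}" "z = 1 / (b j * q ^ Suc k)" | j k where "j \<in> {1..4}" "z = b j * q ^ k"
      unfolding aw_domain_iff s6' by blast
    then show "winding_number ((*) (1/q) \<circ> \<gamma>) z = winding_number \<gamma> z"
    proof cases
      case 1
      then show ?thesis
        using winding_number_scale [OF s(1,3), of "1/q"] q0 by simp
    next
      case 2
      have "z = 1 / q * (1 / (b j * q ^ k))" using 2 by simp
      then have "winding_number ((*) (1/q) \<circ> \<gamma>) z = winding_number \<gamma> (1 / (b j * q ^ k))"
        using winding_number_scale [OF s(1), of "1 / (b j * q ^ k)" "1/q"] s(6) [OF 2(1), of k] q0 by simp
      then show ?thesis
        using s(6) [OF 2(1)] 2(2) by metis
    next
      case 3
      have "z = 1 / q * (b j * q ^ Suc k)" using 3 q0 by simp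
      then have "winding_number ((*) (1/q) \<circ> \<gamma>) z = winding_number \<gamma> (b j * q ^ Suc k)"
        using winding_number_scale [OF s(1), of "b j * q ^ Suc k" "1/q"] s(5) [OF 3(1), of "Suc k"] q0 by simp
      then show ?thesis
        using s(5) [OF 3(1)] 3(2) by metis
    qed
  qed (use s(1,2) path_image_aw_domain_shift [OF sep] in auto)
  also have "contour_integral ((*) (1/q) \<circ> \<gamma>) f = contour_integral \<gamma> (\<lambda>z. 1 / q * f (z / q))"
    using contour_integral_scale [OF s(1), of "1/q" f] by simp
  finally show ?thesis by simp
qed

text \<open>Here f plays the part of the telescoping term: its families q b and b become b and q b
  at u/q. Over the denominator for b the difference is the right-hand side of
  \<open>beta_identity\<close> with its parameter b equal to b_j. Theta(u/q) = u^4 Theta(u)/q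
  supplies the relative power u^4 of the two terms, and 1/q is the Jacobian of the shift.\<close>

lemma aw_pointwise:
  assumes u: "u \<in> aw_domain q b b" and j: "j \<in> {1..4}"
  defines "b' \<equiv> b(j := q * b j)"
  defines "f \<equiv> (\<lambda>u. b j * vwp_sum q (\<lambda>j. 0) u / (u^2 * aw_denom q (\<lambda>j. q * b j) b u))"
  shows "(\<Prod>k\<in>{1..4}-{j}. 1 - b j * b k) * aw_integrand q b u
      - (1 - (\<Prod>k=1..4. b k)) * aw_integrand q b' u = f u - 1 / q * f (u / q)"
proof -
  have q0: "q \<noteq> 0" using q by auto
  have u0: "u \<noteq> 0" using u by (simp add: aw_domain_def)
  obtain k1 k2 k3 where k: "{1..4} - {j} = {k1, k2, k3}" "distinct [j, k1, k2, k3]"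
    and p: "\<And>f :: nat \<Rightarrow> complex. (\<Prod>i=1..4. f i) = f j * f k1 * f k2 * f k3"
  proof (rule prod_1_4_split [OF j])
    fix k1 k2 k3
    assume *: "{1..4} - {j} = {k1, k2, k3}" "distinct [j, k1, k2, k3]"
      "\<And>f :: nat \<Rightarrow> complex. (\<Prod>i=1..4. f i) = f j * f k1 * f k2 * f k3"
    show thesis by (rule that [OF *])
  qed
  define P where "P = (\<lambda>a. qpoch_inf a q)"
  have P: "qpoch_inf a q = P a" for a by (simp add: P_def)
  have P1: "P y = (1 - y) * P (q * y)" for y
    unfolding P_def by (rule qpoch_inf_rec [OF q])
  have b': "b' j = q * b j" "b' k1 = b k1" "b' k2 = b k2" "b' k3 = b k3"
    using k by (auto simp: b'_def)
  define A where "A = P (q * b j * u) * P (q * b j / u) * (P (q * b k1 * u) * P (q * b k1 / u))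
    * (P (q * b k2 * u) * P (q * b k2 / u)) * (P (q * b k3 * u) * P (q * b k3 / u))"
  define M where "M = (1 - b k1 / u) * (1 - b k2 / u) * (1 - b k3 / u)"
  define N where "N = (1 - b k1 * u) * (1 - b k2 * u) * (1 - b k3 * u)"
  have a: "q * (y / u) = q * y / u" "q * (y * u) = q * y * u" for y
    by simp_all
  have D1: "aw_denom q b b u = ((1 - b j * u) * N) * ((1 - b j / u) * M) * A"
    unfolding aw_denom_def p A_def M_def N_def P P1 [of "b j * u"] P1 [of "b j / u"]
      P1 [of "b k1 * u"] P1 [of "b k1 / u"] P1 [of "b k2 * u"] P1 [of "b k2 / u"]
      P1 [of "b k3 * u"] P1 [of "b k3 / u"] a
    by (simp only: mult_ac times_divide_eq_right)
  have D2: "aw_denom q b' b' u = N * M * A"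
    unfolding aw_denom_def p b' A_def M_def N_def P
      P1 [of "b k1 * u"] P1 [of "b k1 / u"] P1 [of "b k2 * u"] P1 [of "b k2 / u"]
      P1 [of "b k3 * u"] P1 [of "b k3 / u"] a
    by (simp only: mult_ac times_divide_eq_right)
  have D3: "aw_denom q (\<lambda>j. q * b j) b u = (1 - b j / u) * M * A"
    unfolding aw_denom_def p A_def M_def P P1 [of "b j / u"] P1 [of "b k1 / u"] P1 [of "b k2 / u"]
      P1 [of "b k3 / u"] a
    by (simp only: mult_ac times_divide_eq_right)
  have c: "q * y * (u / q) = y * u" "y / (u / q) = q * y / u" for y
    using q0 by simp_all
  have D4: "aw_denom q (\<lambda>j. q * b j) b (u / q) = (1 - b j * u) * N * A"
    unfolding aw_denom_def p c A_def N_def P P1 [of "b j * u"] P1 [of "b k1 * u"] P1 [of "b k2 * u"]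
      P1 [of "b k3 * u"] a
    by (simp only: mult_ac times_divide_eq_right)
  define \<Theta> where "\<Theta> = vwp_sum q (\<lambda>j. 0) u"
  have \<Theta>: "vwp_sum q (\<lambda>j. 0) (u / q) = u^4 * \<Theta> / q"
    using vwp_sum_q_shift [of "u / q" "\<lambda>j. 0"] u0 q0 by (simp add: \<Theta>_def field_simps eval_nat_numeral)
  have prodk: "(\<Prod>k\<in>{1..4}-{j}. 1 - b j * b k) = (1 - b j * b k1) * (1 - b j * b k2) * (1 - b j * b k3)"
    unfolding k(1) using k(2) by (simp add: mult_ac)
  have nz: "1 - b j * u \<noteq> 0" "N \<noteq> 0" "1 - b j / u \<noteq> 0" "M \<noteq> 0" "A \<noteq> 0"
  proof -
    have "aw_denom q b b u \<noteq> 0" using u by (simp add: aw_domain_def)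
    then show "1 - b j * u \<noteq> 0" "N \<noteq> 0" "1 - b j / u \<noteq> 0" "M \<noteq> 0" "A \<noteq> 0"
      unfolding D1 by simp_all
  qed
  have "((1 - b j * b k1) * (1 - b j * b k2) * (1 - b j * b k3) - (1 - b j * b k1 * b k2 * b k3)
        * ((1 - b j * u) * (1 - b j / u))) * (u^2 - 1)
      = b j * u^3 * ((1 - b j / u) * (1 - b k1 / u) * (1 - b k2 / u) * (1 - b k3 / u))
        - b j / u * ((1 - b j * u) * (1 - b k1 * u) * (1 - b k2 * u) * (1 - b k3 * u))"
    by (rule beta_identity [OF u0])
  then have key: "((1 - b j * b k1) * (1 - b j * b k2) * (1 - b j * b k3) - (1 - b j * b k1 * b k2 * b k3)
        * ((1 - b j * u) * (1 - b j / u))) * (u^2 - 1)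
      = b j * u^3 * ((1 - b j / u) * M) - b j / u * ((1 - b j * u) * N)"
    unfolding M_def N_def by (simp only: mult.assoc)
  \<comment> \<open>Field arithmetic with abbreviated products: p and m stand for 1 - b_j u and 1 -
    b_j/u, X and Y for the two recurrence factors. The key identity enters with a sign, since it has
    u^2 - 1 where the weight has 1 - u^2.\<close>
  have alg: "X * ((1 - u^2) * \<Theta> / (u * (p * N * (m * M) * A))) - Y * ((1 - u^2) * \<Theta> / (u * (N * M * A)))
     = \<beta> * \<Theta> / (u^2 * (m * M * A)) - 1 / q * (\<beta> * (u^4 * \<Theta> / q) / ((u/q)^2 * (p * N * A)))"
    if "(X - Y * (p * m)) * (u^2 - 1) = \<beta> * u^3 * (m * M) - \<beta> / u * (p * N)" "p \<noteq> 0" "m \<noteq> 0" for X Y p m \<beta>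
  proof -
    have "X * ((1 - u^2) * \<Theta> / (u * (p * N * (m * M) * A))) - Y * ((1 - u^2) * \<Theta> / (u * (N * M * A)))
       = - ((X - Y * (p * m)) * (u^2 - 1)) * (\<Theta> / (u * (p * N * (m * M) * A)))"
      using that nz u0 by (simp add: field_simps)
    also have "\<dots> = (\<beta> / u * (p * N)) * (\<Theta> / (u * (p * N * (m * M) * A))) -
        (\<beta> * u^3 * (m * M)) * (\<Theta> / (u * (p * N * (m * M) * A)))"
      unfolding that(1) by (simp only: minus_diff_eq left_diff_distrib)
    also have "(\<beta> / u * (p * N)) * (\<Theta> / (u * (p * N * (m * M) * A))) = \<beta> * \<Theta> / (u^2 * (m * M * A))"
      using that nz u0 by (simp add: power2_eq_square)
    also have "(\<beta> * u^3 * (m * M)) * (\<Theta> / (u * (p * N * (m * M) * A))) = 1 / q * (\<beta> * (u^4 * \<Theta> / q) / ((u/q)^2 * (p * N * A)))"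
      using that nz u0 q0 by (simp add: eval_nat_numeral)
    finally show ?thesis .
  qed
  show ?thesis
    unfolding f_def aw_integrand_def D1 D2 D3 D4 \<Theta> \<Theta>_def [symmetric] p prodk
    by (rule alg [OF key nz(1,3)])
qed

lemma aw_recurrence:
  assumes sep: "separating_contour q s b 0 \<gamma>" and j: "j \<in> {1..4}"
  shows "(\<Prod>k\<in>{1..4}-{j}. 1 - b j * b k) * contour_integral \<gamma> (aw_integrand q b)
      = (1 - (\<Prod>k=1..4. b k)) * contour_integral \<gamma> (aw_integrand q (b(j := q * b j)))"
proof -
  let ?b' = "b(j := q * b j)"
  let ?r = "\<Prod>k\<in>{1..4}-{j}. 1 - b j * b k" and ?p = "1 - (\<Prod>k=1..4. b k)"
  note s = separating_contour_0 [OF sep]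
  note sep' = separating_contour_0_scale [OF sep j]
  define f where "f = (\<lambda>u. b j * vwp_sum q (\<lambda>j. 0) u / (u^2 * aw_denom q (\<lambda>j. q * b j) b u))"
  have "aw_domain q (\<lambda>j. q * b j) b \<subseteq> - {0}" by (auto simp: aw_domain_def)
  then have f: "f holomorphic_on aw_domain q (\<lambda>j. q * b j) b"
    unfolding f_def
    by (intro holomorphic_on_divide holomorphic_on_mult holomorphic_on_power
        holomorphic_on_const holomorphic_on_ident holomorphic_on_subset [OF theta_holomorphic]
        holomorphic_on_subset [OF aw_denom_holomorphic]) (auto simp: aw_domain_def)
  have int: "aw_integrand q b contour_integrable_on \<gamma>" "aw_integrand q ?b' contour_integrable_on \<gamma>"
      "f contour_integrable_on \<gamma>"
    using contour_integrable_holomorphic_simple [OF aw_integrand_holomorphic open_aw_domain s(1)]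
      contour_integrable_holomorphic_simple [OF f open_aw_domain s(1)]
      path_image_aw_domain [OF sep] path_image_aw_domain [OF sep'] path_image_aw_domain_shift(1) [OF sep] by blast+
  have "contour_integral \<gamma> f = contour_integral \<gamma> (\<lambda>z. 1 / q * f (z / q))"
    by (rule aw_shift_invariance [OF sep f])
  \<comment> \<open>Solved for f(u/q)/q, the pointwise identity requires integrability only of the
    three functions in \<open>int\<close>.\<close>
  also have "\<dots> = contour_integral \<gamma> (\<lambda>u. f u - (?r * aw_integrand q b u - ?p * aw_integrand q ?b' u))"
  proof (rule contour_integral_eq)
    fix u assume "u \<in> path_image \<gamma>"
    then have "u \<in> aw_domain q b b" using path_image_aw_domain [OF sep] by blast
    from aw_pointwise [OF this j]
    show "1 / q * f (u / q) = f u - (?r * aw_integrand q b u - ?p * aw_integrand q ?b' u)"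
      unfolding f_def by (simp only: diff_diff_eq2 add_diff_cancel_left')
  qed
  also have "\<dots> = contour_integral \<gamma> f - (?r * contour_integral \<gamma> (aw_integrand q b)
      - ?p * contour_integral \<gamma> (aw_integrand q ?b'))"
    using int by (simp add: contour_integral_diff contour_integral_lmul contour_integrable_diff contour_integrable_lmul
        del: fun_upd_apply)
  finally show ?thesis by simp
qed

text \<open>As a function \<open>F\<close> of the scale t and of u the denominator is jointly
  continuous on a compact set and equals 1 at t = 0; uniform continuity gives uniform convergence
  along t = q^N.\<close>

lemma aw_integrand_uniform_limit:
  assumes K: "compact K" "K \<subseteq> - {0}"
  shows "uniform_limit K (\<lambda>N. aw_integrand q (\<lambda>j. q ^ N * b j))
    (\<lambda>u. (1 - u^2) * vwp_sum q (\<lambda>j. 0) u / u) sequentially"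
proof -
  define F where "F = (\<lambda>z. \<Prod>j=1..4. qpoch_inf (fst z * b j * snd z) q * qpoch_inf (fst z * b j / snd z) q)"
  have "continuous_on (cball 0 1 \<times> K) F"
    unfolding F_def using K(2)
    by (intro continuous_on_prod continuous_on_mult continuous_on_qpoch_inf [OF q] continuous_on_divide
        continuous_on_fst continuous_on_snd continuous_on_id continuous_on_const) auto
  then have uc: "uniformly_continuous_on (cball 0 1 \<times> K) F"
    by (intro compact_uniformly_continuous compact_Times compact_cball K)
  have F0: "F (0, u) = 1" for u
    by (simp add: F_def qpoch_inf_0 [OF q])
  have lim: "uniform_limit K (\<lambda>N u. F (q ^ N, u)) (\<lambda>u. 1) sequentially"
  proof (rule uniform_limitI)
    fix e :: real assume "e > 0"
    then obtain d where d: "d > 0" "\<And>z z'. z \<in> cball 0 1 \<times> K \<Longrightarrow> z' \<in> cball 0 1 \<times> K \<Longrightarrow> dist z' z < d \<Longrightarrow> dist (F z') (F z) < e"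
      using uc unfolding uniformly_continuous_on_def by blast
    have "(\<lambda>N. q ^ N) \<longlonglongrightarrow> 0" using q by (intro LIMSEQ_power_zero)
    then have "\<forall>\<^sub>F N in sequentially. dist (q ^ N) 0 < d"
      using d(1) by (rule tendstoD)
    then show "\<forall>\<^sub>F N in sequentially. \<forall>u\<in>K. dist (F (q ^ N, u)) 1 < e"
    proof eventually_elim
      case (elim N)
      show ?case
      proof
        fix u assume u: "u \<in> K"
        have "dist (F (q ^ N, u)) (F (0, u)) < e"
          using u elim q by (intro d(2)) (auto simp: dist_Pair_Pair norm_power power_le_one)
        then show "dist (F (q ^ N, u)) 1 < e" by (simp add: F0)
      qed
    qed
  qed
  define G where "G = (\<lambda>u. (1 - u^2) * vwp_sum q (\<lambda>j. 0) u / u)"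
  have "continuous_on K G"
    unfolding G_def using K(2)
    by (intro continuous_intros holomorphic_on_imp_continuous_on holomorphic_on_subset [OF theta_holomorphic]) auto
  then have "bounded (G ` K)"
    by (intro compact_imp_bounded compact_continuous_image K)
  then have "uniform_limit K (\<lambda>N u. G u / F (q ^ N, u)) (\<lambda>u. G u / 1) sequentially"
    by (intro uniform_lim_divide [OF uniform_limit_const lim, where b = 1]) auto
  moreover have "(\<lambda>N u. G u / F (q ^ N, u)) = (\<lambda>N. aw_integrand q (\<lambda>j. q ^ N * b j))"
    by (simp add: fun_eq_iff aw_integrand_def aw_denom_def F_def G_def)
  ultimately show ?thesis by (simp add: G_def)
qed

text \<open>At x = 0 the m-th term times 1 - u^2 is q^(2m^2-m) times (1 + q^(2m)) u^(-4m) -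
  u^(-4m+2) - q^(2m) u^(-4m-2). The exponents -4m + 2 and -4m - 2 are never 0, and -4m is 0 only for
  m = 0, where the coefficient is 1 + 1.\<close>

lemma theta_constant_term:
  assumes \<gamma>: "valid_path \<gamma>" "pathfinish \<gamma> = pathstart \<gamma>" "0 \<notin> path_image \<gamma>" "winding_number \<gamma> 0 = 1"
  shows "contour_integral \<gamma> (\<lambda>u. (1 - u^2) * vwp_sum q (\<lambda>j. 0) u / u) = 4 * pi * \<i>"
proof -
  have q0: "q \<noteq> 0" using q by auto
  define g where "g = (\<lambda>m u. (1 - u^2) * vwp_term q (\<lambda>j. 0) u m / u)"
  have pi: "path_image \<gamma> \<subseteq> - {0}" using \<gamma>(3) by blast
  have hol: "(\<lambda>u. \<Sum>m\<in>F. g m u) holomorphic_on - {0}" for F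
    unfolding g_def
    by (intro holomorphic_on_sum holomorphic_on_divide holomorphic_on_mult holomorphic_on_diff holomorphic_on_power
        holomorphic_on_const holomorphic_on_ident vwp_term_holomorphic [OF q]) auto
  have hol1: "g m holomorphic_on - {0}" for m using hol [of "{m}"] by simp
  have lim: "((\<lambda>F. contour_integral \<gamma> (\<lambda>u. \<Sum>m\<in>F. g m u)) \<longlongrightarrow>
      contour_integral \<gamma> (\<lambda>u. (1 - u^2) * vwp_sum q (\<lambda>j. 0) u / u)) (finite_subsets_at_top UNIV)"
  proof (rule contour_integral_tendsto [OF _ \<gamma>(1) pi])
    show "(\<lambda>u. (1 - u^2) * vwp_sum q (\<lambda>j. 0) u / u) holomorphic_on - {0}"
      by (intro holomorphic_on_divide holomorphic_on_mult holomorphic_on_diff holomorphic_on_power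
        holomorphic_on_const holomorphic_on_ident theta_holomorphic) auto
    fix K :: "complex set" assume K: "compact K" "K \<subseteq> - {0}"
    have "uniform_limit K (\<lambda>F u. \<Sum>m\<in>F. vwp_term q (\<lambda>j. 0 * 1) u m)
        (vwp_sum q (\<lambda>j. 0 * 1)) (finite_subsets_at_top UNIV)"
      using q by (intro vwp_sum_uniform_limit [OF q _ _ _ K]) auto
    then have ul: "uniform_limit K (\<lambda>F u. \<Sum>m\<in>F. vwp_term q (\<lambda>j. 0) u m)
        (vwp_sum q (\<lambda>j. 0)) (finite_subsets_at_top UNIV)" by simp
    have "bounded ((\<lambda>u. (1 - u^2) / u) ` K)" "bounded (vwp_sum q (\<lambda>j. 0) ` K)"
      using K holomorphic_on_imp_continuous_on [OF holomorphic_on_subset [OF theta_holomorphic K(2)]]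
      by (auto intro!: compact_imp_bounded compact_continuous_image continuous_intros)
    then have "uniform_limit K (\<lambda>F u. (1 - u^2) / u * (\<Sum>m\<in>F. vwp_term q (\<lambda>j. 0) u m))
      (\<lambda>u. (1 - u^2) / u * vwp_sum q (\<lambda>j. 0) u) (finite_subsets_at_top UNIV)"
      by (intro uniform_lim_mult uniform_limit_const ul)
    then show "uniform_limit K (\<lambda>F u. \<Sum>m\<in>F. g m u) (\<lambda>u. (1 - u^2) * vwp_sum q (\<lambda>j. 0) u / u) (finite_subsets_at_top UNIV)"
      by (simp add: g_def sum_distrib_left sum_divide_distrib)
  qed (use hol in auto)
  have int: "contour_integral \<gamma> (g m) = (if m = 0 then 4 * pi * \<i> else 0)" for m
  proof -
    have "contour_integral \<gamma> (g m) = contour_integral \<gamma> (\<lambda>u.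
        q powi (2*m*m - m) * ((1 + q powi (2 * m)) * u powi (-4*m - 1) - u powi ((-4*m + 2) - 1)
          - q powi (2 * m) * u powi ((-4*m - 2) - 1)))"
    proof (rule contour_integral_eq)
      fix u assume "u \<in> path_image \<gamma>"
      then have u: "u \<noteq> 0" using \<gamma>(3) by auto
      define W X Q where "W = q powi (2*m*m - m)" and "X = u powi (-4*m)" and "Q = q powi (2 * m)"
      have e: "u powi ((-4*m + 2) - 1) = X * u" "u powi (-4*m - 1) = X / u" "u powi ((-4*m - 2) - 1) = X / u^3"
      proof -
        have "(-4*m + 2) - 1 = -4*m + 1" "(-4*m - 2) - 1 = -4*m + (-3)" by simp_all
        then show "u powi ((-4*m + 2) - 1) = X * u" "u powi (-4*m - 1) = X / u" "u powi ((-4*m - 2) - 1) = X / u^3"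
          unfolding X_def using u
          by (simp_all only: power_int_add [of u] power_int_diff [of u] simp_thms) (simp_all add: power_int_minus divide_inverse)
      qed
      have v: "(u * q powi (-m)) powi (-2) = Q / u^2"
        unfolding Q_def using u q0
        by (simp add: power_int_mult_distrib power_int_minus field_simps flip: power_int_mult)
           (simp add: power_int_mult power2_eq_square mult.commute)
      have "psi_term q e (\<lambda>j. q * 0) (\<lambda>j. q * 0) u m = (u * q powi (-m)) powi e * (W * X)" for e
        unfolding psi_term_def W_def X_def by (simp add: qpoch_inf_0 [OF q])
      then have "g m u = (1 - u^2) * (W * X - Q / u^2 * (W * X)) / u"
        unfolding g_def vwp_term_def v [symmetric] by simp
      also have "\<dots> = W * ((1 + Q) * (X / u) - X * u - Q * (X / u^3))"
        using u by (simp add: field_simps eval_nat_numeral)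
      finally show "g m u = q powi (2*m*m - m) * ((1 + q powi (2 * m)) * u powi (-4*m - 1) - u powi ((-4*m + 2) - 1)
          - q powi (2 * m) * u powi ((-4*m - 2) - 1))"
        unfolding e W_def Q_def .
    qed
    also have "\<dots> = q powi (2*m*m - m) * ((1 + q powi (2 * m)) * (if -4*m = 0 then 2 * pi * \<i> else 0)
        - (if -4*m + 2 = 0 then 2 * pi * \<i> else 0) - q powi (2 * m) * (if -4*m - 2 = 0 then 2 * pi * \<i> else 0))"
    proof (rule contour_integral_unique)
      have pw: "((\<lambda>z. z powi (k - 1)) has_contour_integral (if k = 0 then 2 * pi * \<i> else 0)) \<gamma>" for k
      proof -
        have "(\<lambda>z. z powi (k - 1)) contour_integrable_on \<gamma>"
          by (rule contour_integrable_holomorphic_simple [OF _ _ \<gamma>(1) pi])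
             (auto intro!: holomorphic_intros)
        then show ?thesis
          using contour_integral_powi [OF \<gamma>(1-3), of k] \<gamma>(4) by (auto simp: has_contour_integral_integral dest: has_contour_integral_integral)
      qed
      show "((\<lambda>u. q powi (2*m*m - m) * ((1 + q powi (2 * m)) * u powi (-4*m - 1) - u powi ((-4*m + 2) - 1)
          - q powi (2 * m) * u powi ((-4*m - 2) - 1))) has_contour_integral
          q powi (2*m*m - m) * ((1 + q powi (2 * m)) * (if -4*m = 0 then 2 * pi * \<i> else 0)
        - (if -4*m + 2 = 0 then 2 * pi * \<i> else 0) - q powi (2 * m) * (if -4*m - 2 = 0 then 2 * pi * \<i> else 0))) \<gamma>"
        by (intro has_contour_integral_lmul has_contour_integral_diff pw)
    qed
    also have "\<dots> = (if m = 0 then 4 * pi * \<i> else 0)"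
    proof -
      have "-4*m + 2 \<noteq> 0" "-4*m - 2 \<noteq> 0" by presburger+
      then show ?thesis by (simp only: if_False) simp
    qed
    finally show ?thesis .
  qed
  have "contour_integral \<gamma> (\<lambda>u. \<Sum>m\<in>F. g m u) = (\<Sum>m\<in>F. if m = 0 then 4 * pi * \<i> else 0)" if "finite F" for F
    unfolding int [symmetric] using that
    by (intro contour_integral_sum) (auto intro: contour_integrable_holomorphic_simple [OF hol1 _ \<gamma>(1) pi])
  \<comment> \<open>The net of partial integrals is constant from the index set {0} on.\<close>
  then have "\<forall>\<^sub>F F in finite_subsets_at_top UNIV. contour_integral \<gamma> (\<lambda>u. \<Sum>m\<in>F. g m u) = 4 * pi * \<i>"
    unfolding eventually_finite_subsets_at_top by (intro exI [of _ "{0}"]) (auto simp: sum.delta)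
  then have "((\<lambda>F. contour_integral \<gamma> (\<lambda>u. \<Sum>m\<in>F. g m u)) \<longlongrightarrow> 4 * pi * \<i>) (finite_subsets_at_top UNIV)"
    by (rule tendsto_eventually)
  then show ?thesis
    using tendsto_unique [OF finite_subsets_at_top_neq_bot lim] by simp
qed

end

section \<open>Comparison of the contours for different m\<close>

lemma contour_integral_separating_eq:
  assumes q: "0 < norm q" "norm q < 1"
    and sep: "separating_contour q s b 0 \<gamma>" "separating_contour q s b 0 \<delta>"
    and f: "f holomorphic_on aw_domain q b b"
  shows "contour_integral \<gamma> f = contour_integral \<delta> f"
proof (rule contour_integral_eq_homologous [OF open_aw_domain [OF q] connected_aw_domain [OF q] f])
  fix z assume "z \<notin> aw_domain q b b"
  then consider "z = 0" | j k where "j \<in> {1..4}" "z = 1 / (b j * q ^ k)" | j k where "j \<in> {1..4}" "z = b j * q ^ k"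
    unfolding aw_domain_iff [OF q] by blast
  then show "winding_number \<gamma> z = winding_number \<delta> z"
    using separating_contour_0 [OF sep(1)] separating_contour_0 [OF sep(2)] by cases simp_all
qed (use separating_contour_0 [OF sep(1)] separating_contour_0 [OF sep(2)]
       path_image_aw_domain [OF q] sep in blast)+

text \<open>Multiplication by q^(m/2) carries both families of poles for m onto those for 0, and
  scaling preserves winding numbers.\<close>

lemma separating_contour_rescale:
  assumes "separating_contour q s b m \<gamma>" "s \<noteq> 0"
  shows "separating_contour q s b 0 ((*) (s powi m) \<circ> \<gamma>)"
proof -
  let ?c = "s powi m"
  have c: "?c \<noteq> 0" using assms by simp
  note sep = assms(1) [unfolded separating_contour_def]
  have zero: "poles_to_zero q s b m = (\<lambda>(j, k). s powi (- m) * q ^ k * b j) ` ({1..4} \<times> UNIV)"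
    and infinity: "poles_to_infinity q s b m = (\<lambda>(j, k). s powi (- m) / (q ^ k * b j)) ` ({1..4} \<times> UNIV)" for m
    unfolding poles_to_zero_def poles_to_infinity_def by auto
  have c': "?c * (s powi (- m) * y) = y" "?c * (s powi (- m) / y) = 1 / y" for y
    using assms(2) by (simp_all add: power_int_minus)
  have 0: "poles_to_zero q s b 0 = (*) ?c ` poles_to_zero q s b m"
    unfolding zero image_image by (rule image_cong [OF refl]) (auto simp: c' mult.assoc)
  have i: "poles_to_infinity q s b 0 = (*) ?c ` poles_to_infinity q s b m"
    unfolding infinity image_image by (rule image_cong [OF refl]) (auto simp: c' simp del: times_divide_eq_right)
  have wn: "winding_number ((*) ?c \<circ> \<gamma>) (?c * z) = winding_number \<gamma> z" if "z \<notin> path_image \<gamma>" for z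
    using sep that c by (intro winding_number_scale) auto
  have im: "?c * z \<notin> path_image ((*) ?c \<circ> \<gamma>)" if "z \<notin> path_image \<gamma>" for z
    using that c by (auto simp: path_image_compose)
  show ?thesis
    unfolding separating_contour_def 0 i
  proof (intro conjI)
    show "valid_path ((*) ?c \<circ> \<gamma>)" using sep by (blast intro: valid_path_scale)
    show "pathfinish ((*) ?c \<circ> \<gamma>) = pathstart ((*) ?c \<circ> \<gamma>)"
      using sep by (simp add: pathfinish_compose pathstart_compose)
    show "winding_number ((*) ?c \<circ> \<gamma>) 0 = 1"
      using wn [of 0] sep by auto
    show "path_image ((*) ?c \<circ> \<gamma>) \<inter> ({0} \<union> (*) ?c ` poles_to_zero q s b m \<union> (*) ?c ` poles_to_infinity q s b m) = {}"
      using im im [of 0] sep by auto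
    show "\<forall>p\<in>(*) ?c ` poles_to_zero q s b m. winding_number ((*) ?c \<circ> \<gamma>) p = 1"
    proof clarify
      fix p assume p: "p \<in> poles_to_zero q s b m"
      then have "p \<notin> path_image \<gamma>" using sep by blast
      then show "winding_number ((*) ?c \<circ> \<gamma>) (?c * p) = 1"
        using wn [of p] sep p by simp
    qed
    show "\<forall>p\<in>(*) ?c ` poles_to_infinity q s b m. winding_number ((*) ?c \<circ> \<gamma>) p = 0"
    proof clarify
      fix p assume p: "p \<in> poles_to_infinity q s b m"
      then have "p \<notin> path_image \<gamma>" using sep by blast
      then show "winding_number ((*) ?c \<circ> \<gamma>) (?c * p) = 0"
        using wn [of p] sep p by simp
    qed
  qed
qed

context
  fixes q :: complex
  assumes q: "0 < norm q" "norm q < 1"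
begin

text \<open>Multiplied by the six factorials, the integral absorbs the factors 1 - b_j b_k of
  \<open>aw_recurrence\<close>; both sides then gain just 1 - b_1 b_2 b_3 b_4 at each step. The
  invariant of the descent is that the given contour still separates the poles.\<close>

theorem askey_wilson_integral:
  assumes sep: "separating_contour q s b 0 \<gamma>"
  shows "contour_integral \<gamma> (aw_integrand q b) * (\<Prod>i=1..4. \<Prod>k=i+1..4. qpoch_inf (b i * b k) q)
    = 4 * pi * \<i> * qpoch_inf (\<Prod>j=1..4. b j) q"
proof -
  define L where "L = (\<lambda>y :: nat \<Rightarrow> complex. \<Prod>i=1..4. \<Prod>k=i+1..4. qpoch_inf (y i * y k) q)"
  define X where "X = (\<lambda>y. contour_integral \<gamma> (aw_integrand q y) * L y)"
  define Y where "Y = (\<lambda>y :: nat \<Rightarrow> complex. qpoch_inf (\<Prod>j=1..4. y j) q)"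
  have q0: "q \<noteq> 0" using q by auto
  note s = separating_contour_0 [OF sep]
  have lim1: "(\<lambda>N. qpoch_inf (f N) q) \<longlonglongrightarrow> 1" if "f \<longlonglongrightarrow> 0" for f
    using tendsto_qpoch_inf [OF q that] by (simp add: qpoch_inf_0 [OF q])
  have qN: "(\<lambda>N. q ^ N) \<longlonglongrightarrow> 0"
    using q by (intro LIMSEQ_power_zero)
  have "X b * 1 = Y b * ((4 * pi * \<i>) * 1)"
  proof (rule scaling_recurrence [where q = q and Q = "\<lambda>y. separating_contour q s y 0 \<gamma>" and X = X and Y = Y and y = b])
    show "separating_contour q s b 0 \<gamma>" by (rule sep)
    show "X y = X z \<and> Y y = Y z" if "\<And>j. j \<in> {1..4} \<Longrightarrow> y j = z j" for y z
    proof
      have "aw_denom q y y u = aw_denom q z z u" for u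
        unfolding aw_denom_def by (rule prod.cong [OF refl]) (simp only: that)
      then have "aw_integrand q y = aw_integrand q z"
        by (simp add: aw_integrand_def fun_eq_iff)
      moreover have "L y = L z"
        unfolding L_def by (intro prod.cong refl) (simp add: that)
      ultimately show "X y = X z" by (simp only: X_def)
      have "(\<Prod>j=1..4. y j) = (\<Prod>j=1..4. z j)"
        by (rule prod.cong [OF refl that])
      then show "Y y = Y z" by (simp only: Y_def)
    qed
    have "(\<lambda>N. \<Prod>j=1..4. q ^ N * b j) \<longlonglongrightarrow> (\<Prod>j=(1::nat)..4. 0 * b j)"
      by (intro tendsto_intros qN)
    then show "(\<lambda>N. Y (\<lambda>j. q ^ N * b j)) \<longlonglongrightarrow> 1"
      unfolding Y_def by (intro lim1) simp
    have "(\<lambda>N. L (\<lambda>j. q ^ N * b j)) \<longlonglongrightarrow> (\<Prod>i=(1::nat)..4. \<Prod>k=i+1..4. 1)"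
      unfolding L_def
    proof (intro tendsto_prod lim1)
      fix i k
      have "(\<lambda>N. q ^ N * b i * (q ^ N * b k)) \<longlonglongrightarrow> 0 * b i * (0 * b k)"
        by (intro tendsto_intros qN)
      then show "(\<lambda>N. q ^ N * b i * (q ^ N * b k)) \<longlonglongrightarrow> 0" by simp
    qed
    then have L1: "(\<lambda>N. L (\<lambda>j. q ^ N * b j)) \<longlonglongrightarrow> 1" by simp
    \<comment> \<open>Scaling by q^N only removes poles, so all integrands of the sequence are
      holomorphic on one common open set around the contour.\<close>
    have sub: "aw_domain q b b \<subseteq> aw_domain q (\<lambda>j. q ^ N * b j) (\<lambda>j. q ^ N * b j)" for N
    proof
      fix u assume u: "u \<in> aw_domain q b b"
      have *: "1 / (q ^ N * b j * q ^ k) = 1 / (b j * q ^ (N + k))" "q ^ N * b j * q ^ k = b j * q ^ (N + k)" for j k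
        by (simp_all add: power_add mult_ac)
      show "u \<in> aw_domain q (\<lambda>j. q ^ N * b j) (\<lambda>j. q ^ N * b j)"
        using u unfolding aw_domain_iff [OF q] * by blast
    qed
    have D0: "aw_domain q b b \<subseteq> - {0}" by (auto simp: aw_domain_def)
    have "(\<lambda>N. contour_integral \<gamma> (aw_integrand q (\<lambda>j. q ^ N * b j))) \<longlonglongrightarrow>
        contour_integral \<gamma> (\<lambda>u. (1 - u^2) * vwp_sum q (\<lambda>j. 0) u / u)"
    proof (rule contour_integral_tendsto [OF open_aw_domain [OF q, of b b] s(1) path_image_aw_domain [OF q sep]])
      show "\<forall>\<^sub>F N in sequentially. aw_integrand q (\<lambda>j. q ^ N * b j) holomorphic_on aw_domain q b b"
        by (intro always_eventually allI holomorphic_on_subset [OF aw_integrand_holomorphic [OF q] sub])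
      show "(\<lambda>u. (1 - u^2) * vwp_sum q (\<lambda>j. 0) u / u) holomorphic_on aw_domain q b b"
        by (intro holomorphic_on_divide holomorphic_on_mult holomorphic_on_diff holomorphic_on_power
          holomorphic_on_const holomorphic_on_ident holomorphic_on_subset [OF theta_holomorphic [OF q] D0])
           (use D0 in auto)
      show "uniform_limit K (\<lambda>N. aw_integrand q (\<lambda>j. q ^ N * b j)) (\<lambda>u. (1 - u^2) * vwp_sum q (\<lambda>j. 0) u / u) sequentially"
        if "compact K" "K \<subseteq> aw_domain q b b" for K
        using that D0 by (intro aw_integrand_uniform_limit [OF q]) auto
    qed
    then show "(\<lambda>N. X (\<lambda>j. q ^ N * b j)) \<longlonglongrightarrow> 4 * pi * \<i> * 1"
      unfolding X_def theta_constant_term [OF q s(1-4)] by (intro tendsto_mult L1)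
    fix y j assume y: "separating_contour q s y 0 \<gamma>" and j: "j \<in> {1..4::nat}"
    let ?y' = "y(j := q * y j)"
    have P': "(\<Prod>k=1..4. ?y' k) = q * (\<Prod>k=1..4. y k)"
      using j by (simp add: prod.remove [of _ j])
    define r where "r = (\<Prod>k\<in>{1..4}-{j}. 1 - y j * y k)"
    obtain k1 k2 k3 where k: "{1..4} - {j} = {k1, k2, k3}" "distinct [j, k1, k2, k3]"
      and p: "\<And>g :: nat \<Rightarrow> nat \<Rightarrow> complex. (\<And>i k. g i k = g k i) \<Longrightarrow>
       (\<Prod>i=1..4. \<Prod>k=i+1..4. g i k) = g j k1 * g j k2 * g j k3 * (g k1 k2 * g k1 k3 * g k2 k3)"
    proof (rule prod_1_4_split [OF j])
      fix k1 k2 k3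
      assume *: "{1..4} - {j} = {k1, k2, k3}" "distinct [j, k1, k2, k3]"
        "\<And>g :: nat \<Rightarrow> nat \<Rightarrow> complex. (\<And>i k. g i k = g k i) \<Longrightarrow>
       (\<Prod>i=1..4. \<Prod>k=i+1..4. g i k) = g j k1 * g j k2 * g j k3 * (g k1 k2 * g k1 k3 * g k2 k3)"
      show thesis by (rule that [OF *])
    qed
    let ?P = "\<lambda>z i k. qpoch_inf (z i * z k) q"
    have Lz: "L z = ?P z j k1 * ?P z j k2 * ?P z j k3 * (?P z k1 k2 * ?P z k1 k3 * ?P z k2 k3)" for z
      unfolding L_def by (rule p) (simp only: mult.commute)
    have rr: "r = (1 - y j * y k1) * (1 - y j * y k2) * (1 - y j * y k3)"
      unfolding r_def k(1) using k(2) by (simp add: mult_ac)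
    have y': "?y' j = q * y j" "?y' k1 = y k1" "?y' k2 = y k2" "?y' k3 = y k3" using k(2) by auto
    have L: "L y = r * L ?y'"
      unfolding Lz rr y' qpoch_inf_rec [OF q, of "y j * y k1"] qpoch_inf_rec [OF q, of "y j * y k2"]
        qpoch_inf_rec [OF q, of "y j * y k3"]
      by (simp only: mult_ac)
    have I: "r * contour_integral \<gamma> (aw_integrand q y) = (1 - (\<Prod>k=1..4. y k)) * contour_integral \<gamma> (aw_integrand q ?y')"
      unfolding r_def by (rule aw_recurrence [OF q y j])
    have "X y = (r * contour_integral \<gamma> (aw_integrand q y)) * L ?y'"
      unfolding X_def L by (simp only: mult_ac)
    then have "X y = (1 - (\<Prod>k=1..4. y k)) * X ?y'"
      unfolding I X_def by (simp only: mult_ac)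
    moreover have "Y y = (1 - (\<Prod>k=1..4. y k)) * Y ?y'"
      unfolding Y_def P' by (rule qpoch_inf_rec [OF q])
    ultimately show "separating_contour q s ?y' 0 \<gamma> \<and> (\<exists>r. X y = r * X ?y' \<and> Y y = r * Y ?y')"
      using separating_contour_0_scale [OF y j] by blast
  qed
  then show ?thesis by (simp add: X_def Y_def L_def mult.commute)
qed

end

section \<open>Evaluation of the sum of integrals\<close>

text \<open>With c = q^(m/2) one has u = c z and v = u q^(-m) = z/c: the denominator involves only
  u, the factorials of the numerator only v. As u^(-4m) = q^(-2m^2) z^(-4m), the factor 1/(q^m
  z^(4m)) becomes the Gaussian multiplier q^(2m^2-m) u^(-4m).\<close>

lemma integrand_eq:
  fixes s q z :: complex and m :: int
  assumes s: "s ^ 2 = q" "q \<noteq> 0" and z: "z \<noteq> 0"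
  defines "u \<equiv> s powi m * z"
  shows "integrand q s a b m z = (1 - u^2) * vwp_term q (\<lambda>j. 1 / a j) u m / aw_denom q b b u"
proof -
  have s0: "s \<noteq> 0" using s by auto
  define c where "c = s powi m"
  have c0: "c \<noteq> 0" using s0 by (simp add: c_def)
  have qm: "q powi m = c^2"
    unfolding s(1) [symmetric] c_def using s0 by (simp add: power_int_power power_int_power' mult.commute)
  have e: "s powi (2 + m) = q * c" "s powi (2 - m) = q / c" "s powi (- m) = 1 / c" "q powi (- m) = 1 / c^2"
    using s0 s by (simp_all add: c_def power_int_add power_int_diff power_int_minus divide_inverse qm [unfolded c_def])
  have v: "u * q powi (-m) = z / c"
    unfolding u_def e c_def [symmetric] using c0 by (simp add: power2_eq_square)
  have w: "q powi (2*m*m - m) * u powi (-4*m) = 1 / (q powi m * z powi (4*m))"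
  proof -
    have "u powi (-4*m) = c powi (-4*m) * z powi (-4*m)"
      unfolding u_def c_def by (simp add: power_int_mult_distrib)
    also have "c powi (-4*m) = q powi (-2*m*m)"
      unfolding c_def s(1) [symmetric] by (simp add: power_int_power algebra_simps flip: power_int_mult)
    finally have "q powi (2*m*m - m) * u powi (-4*m) = (q powi (2*m*m - m) * q powi (-2*m*m)) * z powi (-4*m)"
      by simp
    also have "q powi (2*m*m - m) * q powi (-2*m*m) = q powi (-m)"
      using s(2) by (simp flip: power_int_add)
    finally show ?thesis by (simp add: power_int_minus divide_inverse)
  qed
  define N where "N = (\<Prod>j=1..4. qpoch_inf (q * (1 / a j) * u * q powi (-m)) q * qpoch_inf (q * (1 / a j) * q powi m / u) q)"
  have psi: "psi_term q e (\<lambda>j. q * (1 / a j)) (\<lambda>j. q * (1 / a j)) u m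
      = (z / c) powi e * N * (1 / (q powi m * z powi (4*m)))" for e
    unfolding psi_term_def w v N_def ..
  have "N = (\<Prod>j=1..4. qpoch_inf (s powi (2 + m) / (a j * z)) q * qpoch_inf (s powi (2 - m) * z / a j) q)"
    unfolding N_def
  proof (rule prod.cong [OF refl])
    fix j
    have "q * (1 / a j) * u * q powi (-m) = q * (1 / a j) * (u * q powi (-m))"
      by (simp only: mult.assoc)
    also have "\<dots> = s powi (2 - m) * z / a j"
      unfolding v unfolding e by simp
    finally have "q * (1 / a j) * u * q powi (-m) = s powi (2 - m) * z / a j" .
    moreover have "q * (1 / a j) * q powi m / u = s powi (2 + m) / (a j * z)"
      unfolding qm u_def c_def [symmetric] e using c0 by (simp add: power2_eq_square)
    ultimately show "qpoch_inf (q * (1 / a j) * u * q powi (-m)) q * qpoch_inf (q * (1 / a j) * q powi m / u) q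
        = qpoch_inf (s powi (2 + m) / (a j * z)) q * qpoch_inf (s powi (2 - m) * z / a j) q"
      by (simp only: mult.commute)
  qed
  moreover have "aw_denom q b b u = (\<Prod>j=1..4. qpoch_inf (s powi m * b j * z) q * qpoch_inf (s powi (- m) * b j / z) q)"
    unfolding aw_denom_def
  proof (rule prod.cong [OF refl])
    fix j
    have *: "b j * u = s powi m * b j * z" "b j / u = s powi (- m) * b j / z"
      unfolding u_def e c_def [symmetric] by simp_all
    then show "qpoch_inf (b j * u) q * qpoch_inf (b j / u) q
        = qpoch_inf (s powi m * b j * z) q * qpoch_inf (s powi (- m) * b j / z) q"
      by (simp only: *)
  qed
  ultimately have int: "integrand q s a b m z = N / aw_denom q b b u *
       ((1 - q powi m * z powi 2) * (1 - q powi m * z powi (- 2)) / (q powi m * z powi (4 * m)))"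
    unfolding integrand_def by (simp only: prod_dividef)
  \<comment> \<open>The two quadratic factors are 1 - u^2, which stays outside the series, and 1 -
    v^(-2), which is distributed over e = 0 and e = -2.\<close>
  have uz: "q powi m * z powi 2 = u^2" "q powi m * z powi (-2) = (z / c) powi (-2)"
    unfolding qm u_def c_def [symmetric] using z c0
    by (simp_all add: power_mult_distrib power_int_minus power_divide field_simps)
  have "n / d * ((1 - y) * (1 - v) / w) = (1 - y) * (1 * n * (1 / w) - v * n * (1 / w)) / d" for n d y v w :: complex
    by (simp add: divide_inverse algebra_simps)
  then show ?thesis
    unfolding int uz vwp_term_def psi power_int_0_right .
qed

text \<open>With x_j = 1/a_j the condition on the product of the a_j reads |q x_1 x_2 x_3 x_4| < 1,
  which gives geometric decay in m. Each m may have its own contour; after rescaling all of them can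
  be replaced by the one for m = 0.\<close>

theorem proposition4p2:
  fixes q s :: complex
    and a b :: "nat \<Rightarrow> complex"
    and \<gamma> :: "int \<Rightarrow> real \<Rightarrow> complex"
  assumes q: "0 < norm q" "norm q < 1"
    and s: "s ^ 2 = q"
    and nonzero: "\<And>j. j \<in> {1..4} \<Longrightarrow> a j \<noteq> 0 \<and> b j \<noteq> 0"
    and generic: "\<And>m. poles_to_zero q s b m \<inter> poles_to_infinity q s b m = {}"
    and convergence: "norm q < norm (\<Prod>j=1..4. a j)"
    and contour: "\<And>m. separating_contour q s b m (\<gamma> m)"
  shows "((\<lambda>m. contour_integral (\<gamma> m) (\<lambda>z. integrand q s a b m z / (2 * pi * \<i> * z)))
           has_sum
             (2 * qpoch_inf (\<Prod>j=1..4. b j) q / qpoch_inf (q / (\<Prod>j=1..4. a j)) q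
              * (\<Prod>j=1..4. \<Prod>k=j+1..4. qpoch_inf (q / (a j * a k)) q / qpoch_inf (b j * b k) q)))
           UNIV"
proof -
  have q0: "q \<noteq> 0" and s0: "s \<noteq> 0" using q s by auto
  define x where "x = (\<lambda>j. 1 / a j)"
  have x0: "x j \<noteq> 0" if "j \<in> {1..4}" for j using nonzero [OF that] by (simp add: x_def)
  have Px: "q * (\<Prod>j=1..4. x j) = q / (\<Prod>j=1..4. a j)"
    by (simp add: x_def prod_dividef)
  have conv: "norm (q * (\<Prod>j=1..4. x j)) < 1"
    unfolding Px norm_divide using convergence q by (simp add: divide_simps)
  note sep = contour [of 0]
  note s1 = separating_contour_0 [OF sep]
  let ?\<gamma> = "\<gamma> 0"
  let ?D = "aw_domain q b b"
  have D0: "?D \<subseteq> - {0}" by (auto simp: aw_domain_def)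
  \<comment> \<open>The part of the rescaled integrand that does not depend on m, including 1/(2 pi
    i u).\<close>
  define G where "G = (\<lambda>u. (1 - u^2) / (u * aw_denom q b b u * (2 * pi * \<i>)))"
  have G: "G holomorphic_on ?D"
    unfolding G_def
    by (intro holomorphic_on_divide holomorphic_on_mult holomorphic_on_diff holomorphic_on_power
        holomorphic_on_const holomorphic_on_ident holomorphic_on_subset [OF aw_denom_holomorphic [OF q] D0])
       (auto simp: aw_domain_def)
  define H where "H = (\<lambda>m u. G u * vwp_term q x u m)"
  have H: "H m holomorphic_on ?D" for m
    unfolding H_def by (intro holomorphic_on_mult G holomorphic_on_subset [OF vwp_term_holomorphic [OF q] D0])
  have term_eq: "contour_integral (\<gamma> m) (\<lambda>z. integrand q s a b m z / (2 * pi * \<i> * z)) = contour_integral ?\<gamma> (H m)" for m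
  proof -
    let ?c = "s powi m"
    have c0: "?c \<noteq> 0" using s0 by simp
    \<comment> \<open>Invariance of dz/z under scaling: the factor c of the substitution cancels the
      one in 1/(c z).\<close>
    have cancel: "X * V / D / (K * z) = c * (X / (c * z * D * K) * V)" if "c \<noteq> 0" for X V D K z c :: complex
      using that by simp
    have vp: "valid_path (\<gamma> m)" and z0: "0 \<notin> path_image (\<gamma> m)"
      using contour [of m] unfolding separating_contour_def by blast+
    have "contour_integral (\<gamma> m) (\<lambda>z. integrand q s a b m z / (2 * pi * \<i> * z))
        = contour_integral (\<gamma> m) (\<lambda>z. ?c * H m (?c * z))"
    proof (rule contour_integral_eq)
      fix z assume "z \<in> path_image (\<gamma> m)"
      then have "z \<noteq> 0" using z0 by auto
      show "integrand q s a b m z / (2 * pi * \<i> * z) = ?c * H m (?c * z)"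
        unfolding integrand_eq [OF s q0 \<open>z \<noteq> 0\<close>] H_def G_def x_def by (rule cancel [OF c0])
    qed
    also have "\<dots> = contour_integral ((*) ?c \<circ> \<gamma> m) (H m)"
      by (rule contour_integral_scale [OF vp, symmetric])
    also have "\<dots> = contour_integral ?\<gamma> (H m)"
      by (rule contour_integral_separating_eq [OF q separating_contour_rescale [OF contour s0] sep H])
    finally show ?thesis .
  qed
  have "((\<lambda>F. contour_integral ?\<gamma> (\<lambda>u. \<Sum>m\<in>F. H m u)) \<longlongrightarrow>
      contour_integral ?\<gamma> (\<lambda>u. G u * vwp_sum q x u)) (finite_subsets_at_top UNIV)"
  proof (rule contour_integral_tendsto [OF open_aw_domain [OF q] s1(1) path_image_aw_domain [OF q sep]])
    show "\<forall>\<^sub>F F in finite_subsets_at_top UNIV. (\<lambda>u. \<Sum>m\<in>F. H m u) holomorphic_on ?D"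
      by (intro always_eventually allI holomorphic_on_sum H)
    have V: "vwp_sum q x holomorphic_on - {0}"
      using vwp_sum_holomorphic [OF q x0 conv, of 1] by simp
    show "(\<lambda>u. G u * vwp_sum q x u) holomorphic_on ?D"
      by (intro holomorphic_on_mult G holomorphic_on_subset [OF V D0])
    fix K assume K: "compact K" "K \<subseteq> ?D"
    have "uniform_limit K (\<lambda>F u. \<Sum>m\<in>F. vwp_term q x u m) (vwp_sum q x) (finite_subsets_at_top UNIV)"
      using vwp_sum_uniform_limit [OF q x0 conv, of 1 K] K(1) order_trans [OF K(2) D0] by simp
    moreover have "bounded (G ` K)" "bounded (vwp_sum q x ` K)"
      using K D0 V G
      by (auto intro!: compact_imp_bounded compact_continuous_image holomorphic_on_imp_continuous_on
          elim: holomorphic_on_subset)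
    ultimately have "uniform_limit K (\<lambda>F u. G u * (\<Sum>m\<in>F. vwp_term q x u m)) (\<lambda>u. G u * vwp_sum q x u) (finite_subsets_at_top UNIV)"
      by (intro uniform_lim_mult uniform_limit_const)
    then show "uniform_limit K (\<lambda>F u. \<Sum>m\<in>F. H m u) (\<lambda>u. G u * vwp_sum q x u) (finite_subsets_at_top UNIV)"
      by (simp add: H_def sum_distrib_left)
  qed
  moreover have "contour_integral ?\<gamma> (\<lambda>u. \<Sum>m\<in>F. H m u) = (\<Sum>m\<in>F. contour_integral ?\<gamma> (H m))" if "finite F" for F
    using that by (intro contour_integral_sum)
      (auto intro: contour_integrable_holomorphic_simple [OF H open_aw_domain [OF q] s1(1) path_image_aw_domain [OF q sep]])
  then have "\<forall>\<^sub>F F in finite_subsets_at_top UNIV.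
      contour_integral ?\<gamma> (\<lambda>u. \<Sum>m\<in>F. H m u) = (\<Sum>m\<in>F. contour_integral ?\<gamma> (H m))"
    by (intro eventually_finite_subsets_at_top_weakI)
  \<comment> \<open>Limits along finite index sets are what \<open>has_sum\<close> means, so the
    interchange of sum and integral yields unconditional summability at the same time.\<close>
  ultimately have sum: "((\<lambda>m. contour_integral ?\<gamma> (H m)) has_sum contour_integral ?\<gamma> (\<lambda>u. G u * vwp_sum q x u)) UNIV"
    unfolding has_sum_def by (rule Lim_transform_eventually)
  define R where "R = (\<Prod>j=1..4. \<Prod>k=j+1..4. qpoch_inf (q / (a j * a k)) q)"
  define L where "L = (\<Prod>j=1..4. \<Prod>k=j+1..4. qpoch_inf (b j * b k) q)"
  have Q0: "qpoch_inf (q / (\<Prod>j=1..4. a j)) q \<noteq> 0"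
  proof
    assume "qpoch_inf (q / (\<Prod>j=1..4. a j)) q = 0"
    then obtain k where k: "q / (\<Prod>j=1..4. a j) * q ^ k = 1"
      unfolding qpoch_inf_eq_0_iff [OF q] by blast
    have "norm (q / (\<Prod>j=1..4. a j) * q ^ k) \<le> norm (q / (\<Prod>j=1..4. a j)) * 1"
      unfolding norm_mult using q by (intro mult_left_mono) (auto simp: norm_power power_le_one)
    also have "\<dots> < 1" using conv unfolding Px by simp
    finally show False unfolding k by simp
  qed
  have L0: "L \<noteq> 0"
  proof -
    \<comment> \<open>A zero of this factorial would make an inner pole b_j q^i coincide with the
      outer pole 1/b_k, where the winding numbers are 1 and 0.\<close>
    have "qpoch_inf (b j * b k) q \<noteq> 0" if j: "j \<in> {1..4}" "k \<in> {1..4}" for j k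
    proof
      assume "qpoch_inf (b j * b k) q = 0"
      then obtain i where "b j * b k * q ^ i = 1"
        unfolding qpoch_inf_eq_0_iff [OF q] by blast
      then have "b j * q ^ i = 1 / (b k * q ^ 0)"
        using nonzero [OF j(2)] by (simp add: field_simps)
      then show False
        using s1(5) [OF j(1), of i] s1(6) [OF j(2), of 0] by auto
    qed
    then show ?thesis unfolding L_def by (simp add: prod_zero_iff)
  qed
  have RX: "(\<Prod>i=1..4. \<Prod>k=i+1..4. qpoch_inf (q * (x i * x k)) q) = R"
    unfolding R_def x_def by simp
  \<comment> \<open>The 2 pi i here meets the 4 pi i of the integral and leaves the factor 2 of the
    result.\<close>
  define C where "C = R / (qpoch_inf (q / (\<Prod>j=1..4. a j)) q * (2 * pi * \<i>))"
  have "contour_integral ?\<gamma> (\<lambda>u. G u * vwp_sum q x u) = contour_integral ?\<gamma> (\<lambda>u. C * aw_integrand q b u)"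
  proof (rule contour_integral_eq)
    fix u assume "u \<in> path_image ?\<gamma>"
    then have u: "u \<noteq> 0" using s1(3) by auto
    have "qpoch_inf (q / (\<Prod>j=1..4. a j)) q * vwp_sum q x u = R * vwp_sum q (\<lambda>j. 0) u"
      using very_well_poised_6psi6 [OF q u x0 conv] unfolding Px RX .
    then have "vwp_sum q x u = R * vwp_sum q (\<lambda>j. 0) u / qpoch_inf (q / (\<Prod>j=1..4. a j)) q"
      using Q0 by (simp add: field_simps)
    then show "G u * vwp_sum q x u = C * aw_integrand q b u"
      by (simp add: G_def C_def aw_integrand_def mult_ac)
  qed
  also have "\<dots> = C * contour_integral ?\<gamma> (aw_integrand q b)"
    by (intro contour_integral_lmul contour_integrable_holomorphic_simple
        [OF aw_integrand_holomorphic [OF q] open_aw_domain [OF q] s1(1) path_image_aw_domain [OF q sep]])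
  also have "contour_integral ?\<gamma> (aw_integrand q b) = 4 * pi * \<i> * qpoch_inf (\<Prod>j=1..4. b j) q / L"
    using askey_wilson_integral [OF q sep] L0 unfolding L_def [symmetric] by (simp add: field_simps)
  also have "C * (4 * pi * \<i> * qpoch_inf (\<Prod>j=1..4. b j) q / L) =
      2 * qpoch_inf (\<Prod>j=1..4. b j) q / qpoch_inf (q / (\<Prod>j=1..4. a j)) q * (R / L)"
    unfolding C_def by simp
  also have "R / L = (\<Prod>j=1..4. \<Prod>k=j+1..4. qpoch_inf (q / (a j * a k)) q / qpoch_inf (b j * b k) q)"
    unfolding R_def L_def by (simp only: prod_dividef)
  finally show ?thesis
    using sum unfolding term_eq by simp
qed

end
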